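(* Let $\varepsilon^*>0$ be sufficiently small. Then there exists a finite point set $S\subset\mathbb{R}^2$ such that every subset $T\subseteq S$ which intersects every line containing at least $\varepsilon^*|S|$ points of $S$ (i.e., every $\varepsilon^*$-net $T\subseteq S$ for lines) satisfies $$|T|\ge \frac{1}{2\varepsilon^*}\,\log^{1/3}\!\Big(\frac{1}{\varepsilon^*}\Big)\Big/\log\log\Big(\frac{1}{\varepsilon^*}\Big).$$
   Context: Logarithms are to base 2. For a finite point set $S$ in the plane, a set $T\subseteq S$ is an $\varepsilon$-net (with respect to lines) if $T$ contains a point of every line $\ell$ with $|\ell\cap S|\ge \varepsilon|S|$. *)

theory Defs
  imports Complex_Main
begin

definition is_line :: "(real \<times> real) set \<Rightarrow> bool" where
  "is_line L \<longleftrightarrow> (\<exists>a b c. (a, b) \<noteq> (0, 0) \<and> L = {(x, y). a * x + b * y = c})"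

definition eps_net_lines :: "real \<Rightarrow> (real \<times> real) set \<Rightarrow> (real \<times> real) set \<Rightarrow> bool" where
  "eps_net_lines eps S T \<longleftrightarrow> T \<subseteq> S \<and>
     (\<forall>L. is_line L \<and> real (card (L \<inter> S)) \<ge> eps * real (card S) \<longrightarrow> T \<inter> L \<noteq> {})"

end

theory Submission
  imports Defs "HOL-Probability.Probability" "HOL-Real_Asymp.Real_Asymp"
begin

text \<open>
  Sample a sparse random subset \<open>S\<close> of a grid with \<open>O(k)\<close> columns, \<open>s \<approx> k / eps\<close> points in all. For
  the family of lines \<open>y = a x + b\<close> with small slope, the sample is so sparse that, after deletion of
  few points, no line of the family carries more than \<open>k\<close> of them. If \<open>T\<close> is an \<open>eps\<close>-net, its
  complement in \<open>S\<close> then contains no \<open>k\<close> points of any line of the family, so it suffices that such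
  line-free subsets have at most \<open>s / 3\<close> points.

  This is a container argument. Inside a dense subset of the grid, many lines are full on some
  fixed \<open>k\<close> columns. Going through these columns one by one, one picks in the line-free set \<open>I\<close> few
  points lying on as many surviving lines as possible and keeps only the lines through them,
  discarding lines through points of later columns that are already saturated. Since two points
  determine a line, this works down to a stage at which a positive proportion of a column is seen
  to be disjoint from \<open>I\<close>. Iterating, \<open>I\<close> is confined to a set of density \<open>1 / 4096\<close> that depends
  only on the few picked points, and a union bound over these finishes the proof. The sampling
  rate exceeds the rate of picked points by a factor that is exponential in \<open>k log k\<close> already for
  \<open>log s\<close> of order \<open>k ^ 3 log k\<close>.
\<close>

section \<open>Fingerprints and containers\<close>

text \<open>
  The set \<open>F\<close> is the fingerprint of \<open>I\<close>. Taking \<open>I' = F\<close> shows that \<open>A I\<close> is a function of it; the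
  intermediate sets \<open>I'\<close> make the notion stable under sequential composition.
\<close>
definition determined :: "nat \<Rightarrow> ('a set \<Rightarrow> 'b) \<Rightarrow> bool" where
  "determined t A \<longleftrightarrow> (\<forall>I. finite I \<longrightarrow>
     (\<exists>F\<subseteq>I. card F \<le> t \<and> (\<forall>I'. F \<subseteq> I' \<and> I' \<subseteq> I \<longrightarrow> A I' = A I)))"

lemma determinedE:
  assumes "determined t A" "finite I"
  obtains F where "F \<subseteq> I" "card F \<le> t" "\<And>I'. F \<subseteq> I' \<Longrightarrow> I' \<subseteq> I \<Longrightarrow> A I' = A I"
  using assms unfolding determined_def by metis

lemma determined_const: "determined t (\<lambda>_. c)"
  unfolding determined_def by (intro allI impI exI[of _ "{}"]) auto

lemma determined_bind:
  assumes "determined t A" and "\<And>a. determined u (B a)"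
  shows "determined (t + u) (\<lambda>I. B (A I) I)"
  unfolding determined_def
proof (intro allI impI)
  fix I :: "'a set"
  assume "finite I"
  from assms(1) this obtain F where F: "F \<subseteq> I" "card F \<le> t"
    "\<And>I'. F \<subseteq> I' \<Longrightarrow> I' \<subseteq> I \<Longrightarrow> A I' = A I"
    by (rule determinedE) (rule that)
  from assms(2)[of "A I"] \<open>finite I\<close> obtain F' where F': "F' \<subseteq> I" "card F' \<le> u"
    "\<And>I'. F' \<subseteq> I' \<Longrightarrow> I' \<subseteq> I \<Longrightarrow> B (A I) I' = B (A I) I"
    by (rule determinedE) (rule that)
  have "card (F \<union> F') \<le> t + u"
    using F(2) F'(2) card_Un_le[of F F'] by linarith
  moreover have "B (A I') I' = B (A I) I" if "F \<union> F' \<subseteq> I' \<and> I' \<subseteq> I" for I'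
    using that F(3)[of I'] F'(3)[of I'] by simp
  moreover have "F \<union> F' \<subseteq> I" using F(1) F'(1) by (rule Un_least)
  ultimately show "\<exists>F\<subseteq>I. card F \<le> t + u \<and>
      (\<forall>I'. F \<subseteq> I' \<and> I' \<subseteq> I \<longrightarrow> B (A I') I' = B (A I) I)"
    by blast
qed

lemma determined_comp:
  assumes "determined t A"
  shows "determined t (\<lambda>I. g (A I))"
  using determined_bind[OF assms determined_const, of 0 g] by simp

lemma determined_funpow:
  fixes f :: "'s \<Rightarrow> 'a set \<Rightarrow> 's"
  assumes "\<And>x. determined t (f x)"
  shows "determined (n * t) (\<lambda>I. ((\<lambda>x. f x I) ^^ n) x)"
proof (induction n)
  case 0
  show ?case by (simp add: determined_const)
next
  case (Suc n)
  show ?case using determined_bind[OF Suc assms] by (simp add: add.commute)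
qed

definition container_map ::
    "('a set \<Rightarrow> bool) \<Rightarrow> nat \<Rightarrow> real \<Rightarrow> 'a set \<Rightarrow> ('a set \<Rightarrow> 'a set) \<Rightarrow> bool" where
  "container_map Q t c C A \<longleftrightarrow> determined t A \<and>
     (\<forall>I\<subseteq>C. Q I \<longrightarrow> I \<subseteq> A I \<and> A I \<subseteq> C \<and> real (card (A I)) \<le> c)"

lemma container_mapD:
  assumes "container_map Q t c C A" "I \<subseteq> C" "Q I"
  shows "I \<subseteq> A I" "A I \<subseteq> C" "real (card (A I)) \<le> c"
  using assms unfolding container_map_def by auto

lemma container_map_id: "real (card C) \<le> c \<Longrightarrow> container_map Q t c C (\<lambda>_. C)"
  by (simp add: container_map_def determined_const)

lemma container_map_mono:
  assumes "container_map Q t c C A" "c \<le> c'"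
  shows "container_map Q t c' C A"
  unfolding container_map_def
proof (intro conjI allI impI)
  show "determined t A" using assms(1) by (simp add: container_map_def)
  fix I assume "I \<subseteq> C" "Q I"
  from container_mapD[OF assms(1) this] assms(2)
  show "I \<subseteq> A I" "A I \<subseteq> C" "real (card (A I)) \<le> c'" by linarith+
qed

lemma container_map_bind:
  assumes A: "container_map Q t c P A"
    and B: "\<And>C. C \<subseteq> P \<Longrightarrow> real (card C) \<le> c \<Longrightarrow> \<exists>B. container_map Q u c' C B"
  shows "\<exists>A'. container_map Q (t + u) c' P A'"
proof -
  have "\<exists>B. determined u B \<and>
      (C \<subseteq> P \<and> real (card C) \<le> c \<longrightarrow> container_map Q u c' C B)" for C
  proof (cases "C \<subseteq> P \<and> real (card C) \<le> c")
    case True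
    then show ?thesis using B[of C] by (auto simp: container_map_def)
  next
    case False
    then show ?thesis using determined_const[of u C] by blast
  qed
  then obtain B where B: "\<And>C. determined u (B C)"
    "\<And>C. C \<subseteq> P \<Longrightarrow> real (card C) \<le> c \<Longrightarrow> container_map Q u c' C (B C)"
    by metis
  have "I \<subseteq> B (A I) I \<and> B (A I) I \<subseteq> P \<and> real (card (B (A I) I)) \<le> c'" if "I \<subseteq> P" "Q I" for I
  proof -
    note A = container_mapD[OF A that]
    show ?thesis using container_mapD[OF B(2)[OF A(2,3)] A(1) that(2)] A(2) by auto
  qed
  moreover have "determined (t + u) (\<lambda>I. B (A I) I)"
    using A B(1) by (intro determined_bind) (simp add: container_map_def)
  ultimately show ?thesis
    unfolding container_map_def by (intro exI[of _ "\<lambda>I. B (A I) I"]) simp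
qed

lemma container_map_iterate:
  assumes \<delta>: "0 \<le> \<delta>"
    and shrink: "\<And>C. C \<subseteq> P \<Longrightarrow> c \<le> real (card C) \<Longrightarrow>
      \<exists>A. container_map Q t (real (card C) - \<delta>) C A"
  shows "\<exists>A. container_map Q (n * t) (max c (real (card P) - real n * \<delta>)) P A"
proof (induction n)
  case 0
  show ?case by (intro exI[of _ "\<lambda>_. P"] container_map_id) simp
next
  case (Suc n)
  let ?b = "\<lambda>n. max c (real (card P) - real n * \<delta>)"
  obtain A where "container_map Q (n * t) (?b n) P A" using Suc by blast
  moreover have "\<exists>B. container_map Q t (?b (Suc n)) C B"
    if C: "C \<subseteq> P" "real (card C) \<le> ?b n" for C
  proof (cases "c \<le> real (card C)")
    case True
    then obtain B where "container_map Q t (real (card C) - \<delta>) C B" using shrink C(1) by blast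
    moreover have "real (card C) - \<delta> \<le> ?b (Suc n)"
      using C(2) \<delta> by (auto simp: max_def algebra_simps split: if_splits)
    ultimately show ?thesis by (blast intro: container_map_mono)
  next
    case False
    then show ?thesis by (intro exI[of _ "\<lambda>_. C"] container_map_id) simp
  qed
  ultimately have "\<exists>A. container_map Q (n * t + t) (?b (Suc n)) P A" by (rule container_map_bind)
  then show ?case by (simp add: add.commute)
qed

lemma container_map_fingerprints:
  assumes "container_map Q t c P A" "finite P" "0 \<le> c"
  obtains G where "\<And>F. G F \<subseteq> P" "\<And>F. real (card (G F)) \<le> c"
    "\<And>I. I \<subseteq> P \<Longrightarrow> Q I \<Longrightarrow> \<exists>F\<subseteq>I. card F \<le> t \<and> I \<subseteq> G F"
proof
  define G where "G F = (if A F \<subseteq> P \<and> real (card (A F)) \<le> c then A F else {})" for F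
  show "G F \<subseteq> P" "real (card (G F)) \<le> c" for F
    using assms(3) by (auto simp: G_def)
  show "\<exists>F\<subseteq>I. card F \<le> t \<and> I \<subseteq> G F" if I: "I \<subseteq> P" "Q I" for I
  proof -
    have "determined t A" using assms(1) by (simp add: container_map_def)
    then obtain F where F: "F \<subseteq> I" "card F \<le> t" "A F = A I"
      using finite_subset[OF I(1) assms(2)] by (elim determinedE) auto
    then have "I \<subseteq> G F" using container_mapD[OF assms(1) I] by (simp add: G_def)
    then show ?thesis using F by blast
  qed
qed

text \<open>Breaking ties by the order makes the choice independent of the other elements of \<open>Y\<close>.\<close>
definition least_maximiser :: "('v::wellorder \<Rightarrow> 'w::linorder) \<Rightarrow> 'v set \<Rightarrow> 'v" where
  "least_maximiser w Y = (LEAST y. y \<in> Y \<and> (\<forall>z\<in>Y. w z \<le> w y))"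

lemma least_maximiser:
  assumes "finite Y" "Y \<noteq> {}"
  shows "least_maximiser w Y \<in> Y" "z \<in> Y \<Longrightarrow> w z \<le> w (least_maximiser w Y)"
proof -
  have "Max (w ` Y) \<in> w ` Y" using assms by simp
  then obtain y where "y \<in> Y" "w y = Max (w ` Y)" by auto
  then have "y \<in> Y \<and> (\<forall>z\<in>Y. w z \<le> w y)" using assms by simp
  from LeastI[of "\<lambda>y. y \<in> Y \<and> (\<forall>z\<in>Y. w z \<le> w y)", OF this]
  show "least_maximiser w Y \<in> Y" "z \<in> Y \<Longrightarrow> w z \<le> w (least_maximiser w Y)"
    by (simp_all add: least_maximiser_def)
qed

lemma least_maximiser_subset:
  assumes "finite Y" "Y' \<subseteq> Y" "least_maximiser w Y \<in> Y'"
  shows "least_maximiser w Y' = least_maximiser w Y"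
  unfolding least_maximiser_def[of w Y']
proof (rule Least_equality)
  have "Y \<noteq> {}" using assms by auto
  note max = least_maximiser[OF assms(1) this, where w = w]
  show "least_maximiser w Y \<in> Y' \<and> (\<forall>z\<in>Y'. w z \<le> w (least_maximiser w Y))"
    using max assms by auto
  fix y assume y: "y \<in> Y' \<and> (\<forall>z\<in>Y'. w z \<le> w y)"
  have "w z \<le> w y" if "z \<in> Y" for z
    using max(2)[OF that] y assms(3) by (meson order_trans)
  then have "y \<in> Y \<and> (\<forall>z\<in>Y. w z \<le> w y)" using y assms(2) by auto
  then show "least_maximiser w Y \<le> y" unfolding least_maximiser_def by (rule Least_le)
qed

lemma determined_least_maximiser:
  "determined 1 (\<lambda>I. if I `` {j} = {} then c else g (least_maximiser w (I `` {j})))"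
  (is "determined 1 ?A")
  unfolding determined_def
proof (intro allI impI)
  fix I :: "('a \<times> 'b) set"
  assume "finite I"
  then have fin: "finite (I `` {j})" by (rule finite_Image)
  let ?F = "if I `` {j} = {} then {} else {(j, least_maximiser w (I `` {j}))}"
  have "?F \<subseteq> I" using least_maximiser(1)[OF fin] by auto
  moreover have "card ?F \<le> 1" by simp
  moreover have "?A I' = ?A I" if "?F \<subseteq> I' \<and> I' \<subseteq> I" for I'
  proof (cases "I `` {j} = {}")
    case True
    then show ?thesis using that by auto
  next
    case False
    then have mem: "least_maximiser w (I `` {j}) \<in> I' `` {j}" and "I' `` {j} \<subseteq> I `` {j}"
      using that by auto
    then have "least_maximiser w (I' `` {j}) = least_maximiser w (I `` {j})"
      by (intro least_maximiser_subset fin)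
    moreover have "I' `` {j} \<noteq> {}" using mem by blast
    ultimately show ?thesis using False by simp
  qed
  ultimately show "\<exists>F\<subseteq>I. card F \<le> 1 \<and> (\<forall>I'. F \<subseteq> I' \<and> I' \<subseteq> I \<longrightarrow> ?A I' = ?A I)"
    by blast
qed

section \<open>Harvesting the lines through one column\<close>

lemma card_le_card_image_mult:
  fixes d :: real
  assumes "finite A" "\<And>y. real (card {x \<in> A. f x = y}) \<le> d"
  shows "real (card A) \<le> real (card (f ` A)) * d"
proof -
  have "real (card A) = (\<Sum>y\<in>f ` A. real (card {x \<in> A. f x = y}))"
    using sum.image_gen[OF assms(1), of "\<lambda>_. 1::real" f] by simp
  also have "\<dots> \<le> real (card (f ` A)) * d" by (rule sum_bounded_above) (rule assms(2))
  finally show ?thesis .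
qed

locale line_system =
  fixes height :: "'c \<Rightarrow> 'l \<Rightarrow> 'v::wellorder"
  assumes height_unique: "i \<noteq> j \<Longrightarrow> height i l = height i l' \<Longrightarrow> height j l = height j l' \<Longrightarrow> l = l'"
begin

definition trace :: "'c set \<Rightarrow> 'l \<Rightarrow> ('c \<times> 'v) set" where
  "trace J l = (\<lambda>j. (j, height j l)) ` J"

definition pencil :: "'l set \<Rightarrow> 'c \<Rightarrow> 'v \<Rightarrow> 'l set" where
  "pencil L j y = {l \<in> L. height j l = y}"

definition line_free :: "'c set \<Rightarrow> 'l set \<Rightarrow> nat \<Rightarrow> ('c \<times> 'v) set \<Rightarrow> bool" where
  "line_free X L k I \<longleftrightarrow> (\<forall>l\<in>L. card (trace X l \<inter> I) < k)"

lemma card_trace: "card (trace J l) = card J"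
  by (simp add: trace_def card_image inj_on_def)

lemma trace_mono: "J \<subseteq> J' \<Longrightarrow> trace J l \<subseteq> trace J' l"
  by (auto simp: trace_def)

lemma ex_full_trace:
  assumes "k \<le> card (trace X l \<inter> C)"
  shows "\<exists>J\<subseteq>X. card J = k \<and> trace J l \<subseteq> C"
proof -
  have "trace X l \<inter> C = trace {j \<in> X. (j, height j l) \<in> C} l" by (auto simp: trace_def)
  then have "k \<le> card {j \<in> X. (j, height j l) \<in> C}" using assms by (simp add: card_trace)
  then obtain J where "J \<subseteq> {j \<in> X. (j, height j l) \<in> C}" "card J = k"
    by (meson obtain_subset_with_card_n)
  then show ?thesis by (intro exI[of _ J]) (auto simp: trace_def)
qed

lemma pencil_mono: "L \<subseteq> L' \<Longrightarrow> pencil L j y \<subseteq> pencil L' j y"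
  by (auto simp: pencil_def)

lemma pencil_subset: "pencil L j y \<subseteq> L"
  by (auto simp: pencil_def)

lemma finite_pencil: "finite L \<Longrightarrow> finite (pencil L j y)"
  by (simp add: pencil_def)

lemma card_pencil_mono: "finite L' \<Longrightarrow> L \<subseteq> L' \<Longrightarrow> card (pencil L j y) \<le> card (pencil L' j y)"
  by (intro card_mono finite_pencil pencil_mono)

lemma card_le_heights_mult:
  assumes "finite L" "\<And>y. card (pencil L j y) \<le> d"
  shows "card L \<le> card (height j ` L) * d"
proof -
  have "real (card L) \<le> real (card (height j ` L)) * real d"
    using assms by (intro card_le_card_image_mult) (auto simp: pencil_def)
  then show ?thesis by (simp flip: of_nat_mult)
qed

lemma card_mult_le_of_pencils:
  assumes "finite L" "\<And>y. y \<in> Y \<Longrightarrow> d \<le> card (pencil L j y)"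
  shows "card Y * d \<le> card L"
proof (cases "finite Y")
  case True
  have "card Y * d \<le> (\<Sum>y\<in>Y. card (pencil L j y))"
    using sum_bounded_below[of Y d "\<lambda>y. card (pencil L j y)"] assms(2) by simp
  also have "\<dots> = card (\<Union>y\<in>Y. pencil L j y)"
    using True assms(1) by (subst card_UN_disjoint) (auto simp: pencil_def)
  also have "\<dots> \<le> card L" using assms(1) by (intro card_mono) (auto simp: pencil_def)
  finally show ?thesis .
qed simp

definition popular :: "real \<Rightarrow> 'l set \<Rightarrow> 'c \<Rightarrow> 'v set" where
  "popular \<theta> L j = {y. \<theta> \<le> real (card (pencil L j y))}"

lemma popular_subset:
  assumes "0 < \<theta>"
  shows "popular \<theta> L j \<subseteq> height j ` L"
proof
  fix y assume "y \<in> popular \<theta> L j"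
  then have "pencil L j y \<noteq> {}" using assms by (auto simp: popular_def)
  then show "y \<in> height j ` L" by (auto simp: pencil_def)
qed

lemma card_le_popular:
  assumes "finite L" "0 < \<theta>" "\<And>y. real (card (pencil L j y)) \<le> D"
  shows "real (card L) \<le> real (card (popular \<theta> L j)) * D + real (card (height j ` L)) * \<theta>"
proof -
  have "real (card L) = (\<Sum>y\<in>height j ` L. real (card (pencil L j y)))"
    using sum.image_gen[OF assms(1), of "\<lambda>_. 1::real" "height j"] by (simp add: pencil_def)
  also have "\<dots> \<le> (\<Sum>y\<in>height j ` L. (if y \<in> popular \<theta> L j then D else 0) + \<theta>)"
    using assms(2,3) by (intro sum_mono) (auto simp: popular_def add_increasing2)
  also have "\<dots> = real (card (popular \<theta> L j)) * D + real (card (height j ` L)) * \<theta>"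
    using assms(1,2) popular_subset[of \<theta> L j]
    by (simp add: sum.distrib sum.If_cases Int_absorb1)
  finally show ?thesis .
qed

text \<open>
  The set \<open>L'\<close> will hold the lines through the points picked so far in column \<open>j\<close>. The bound \<open>d\<close>
  caps the number of lines of \<open>L'\<close> through a point of a column in \<open>J\<close>.
\<close>
definition available :: "'c set \<Rightarrow> nat \<Rightarrow> 'l set \<Rightarrow> 'l set \<Rightarrow> 'l set" where
  "available J d L L' = {l \<in> L - L'. \<forall>i\<in>J. card (pencil L' i (height i l)) < d}"

definition harvest_step ::
    "'c set \<Rightarrow> nat \<Rightarrow> 'c \<Rightarrow> 'l set \<Rightarrow> 'l set \<Rightarrow> ('c \<times> 'v) set \<Rightarrow> 'l set" where
  "harvest_step J d j L L' I = (let A = available J d L L' in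
     if I `` {j} = {} then L'
     else L' \<union> pencil A j (least_maximiser (\<lambda>y. card (pencil A j y)) (I `` {j})))"

definition harvest :: "'c set \<Rightarrow> nat \<Rightarrow> 'c \<Rightarrow> 'l set \<Rightarrow> nat \<Rightarrow> ('c \<times> 'v) set \<Rightarrow> 'l set" where
  "harvest J d j L t I = ((\<lambda>L'. harvest_step J d j L L' I) ^^ t) {}"

lemma determined_harvest: "determined t (harvest J d j L t)"
proof -
  have "determined 1 (harvest_step J d j L L')" for L'
    unfolding harvest_step_def Let_def by (rule determined_least_maximiser)
  then show ?thesis
    using determined_funpow[of 1 "harvest_step J d j L" t "{}"] by (simp add: harvest_def[abs_def])
qed

lemma harvest_Suc_cases:
  fixes J d j L I t
  defines "L' \<equiv> harvest J d j L t I"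
  defines "A \<equiv> available J d L L'"
  assumes "finite I"
  obtains (unchanged) "I `` {j} = {}" "harvest J d j L (Suc t) I = L'"
  | (pick) v where "(j, v) \<in> I" "\<And>y. (j, y) \<in> I \<Longrightarrow> card (pencil A j y) \<le> card (pencil A j v)"
      "harvest J d j L (Suc t) I = L' \<union> pencil A j v"
proof (cases "I `` {j} = {}")
  case True
  then show ?thesis using unchanged by (simp add: harvest_def harvest_step_def Let_def L'_def)
next
  case False
  have fin: "finite (I `` {j})" using assms(3) by (rule finite_Image)
  let ?v = "least_maximiser (\<lambda>y. card (pencil A j y)) (I `` {j})"
  note max = least_maximiser[OF fin False, where w = "\<lambda>y. card (pencil A j y)"]
  show ?thesis
  proof (rule pick)
    show "(j, ?v) \<in> I" using max(1) by simp
    show "harvest J d j L (Suc t) I = L' \<union> pencil A j ?v"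
      using False by (simp add: harvest_def harvest_step_def Let_def L'_def A_def)
  qed (use max(2) in simp)
qed

lemma available_subset: "available J d L L' \<subseteq> L"
  by (auto simp: available_def)

lemma available_antimono:
  assumes "finite L''" "L' \<subseteq> L''"
  shows "available J d L L'' \<subseteq> available J d L L'"
proof
  fix l assume "l \<in> available J d L L''"
  then have l: "l \<in> L - L''" "\<forall>i\<in>J. card (pencil L'' i (height i l)) < d"
    by (simp_all add: available_def)
  have "card (pencil L' i (height i l)) < d" if "i \<in> J" for i
    using bspec[OF l(2) that] card_pencil_mono[OF assms, of i "height i l"] by linarith
  then show "l \<in> available J d L L'" using l(1) assms(2) by (auto simp: available_def)
qed

lemma harvest_subset: "finite I \<Longrightarrow> harvest J d j L t I \<subseteq> L"
proof (induction t)
  case 0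
  show ?case by (simp add: harvest_def)
next
  case (Suc t)
  from Suc.prems show ?case
  proof (cases rule: harvest_Suc_cases[of I j J d L t])
    case unchanged
    then show ?thesis using Suc by simp
  next
    case (pick v)
    have "pencil (available J d L (harvest J d j L t I)) j v \<subseteq> L"
      using pencil_subset available_subset by (rule subset_trans)
    then show ?thesis using pick(3) Suc by simp
  qed
qed

lemma harvest_incident: "finite I \<Longrightarrow> l \<in> harvest J d j L t I \<Longrightarrow> (j, height j l) \<in> I"
proof (induction t)
  case 0
  then show ?case by (simp add: harvest_def)
next
  case (Suc t)
  from Suc.prems(1) show ?case
  proof (cases rule: harvest_Suc_cases[of I j J d L t])
    case unchanged
    then show ?thesis using Suc by simp
  next
    case (pick v)
    then show ?thesis using Suc by (auto simp: pencil_def)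
  qed
qed

lemma card_pencil_absorb_le:
  assumes fin: "finite L'" and cap: "card (pencil L' i y) \<le> d" and i: "i \<in> J" "j \<noteq> i"
  shows "card (pencil (L' \<union> pencil (available J d L L') j v) i y) \<le> d"
proof (cases "pencil (pencil (available J d L L') j v) i y = {}")
  case True
  then have "pencil (L' \<union> pencil (available J d L L') j v) i y = pencil L' i y"
    by (auto simp: pencil_def)
  then show ?thesis using cap by simp
next
  case False
  then obtain l where l: "l \<in> available J d L L'" "height j l = v" "height i l = y"
    by (auto simp: pencil_def)
  have "pencil (L' \<union> pencil (available J d L L') j v) i y \<subseteq> insert l (pencil L' i y)"
    using height_unique[OF i(2)] l(2,3) by (auto simp: pencil_def)
  then have "card (pencil (L' \<union> pencil (available J d L L') j v) i y)
      \<le> card (insert l (pencil L' i y))"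
    using fin by (intro card_mono) (simp_all add: finite_pencil)
  also have "\<dots> \<le> Suc (card (pencil L' i y))"
    using fin by (simp add: card_insert_if finite_pencil)
  also have "\<dots> \<le> d" using l i(1) by (auto simp: available_def)
  finally show ?thesis .
qed

lemma card_pencil_harvest_le:
  assumes "finite L" "finite I" "i \<in> J" "j \<notin> J"
  shows "card (pencil (harvest J d j L t I) i y) \<le> d"
proof (induction t)
  case 0
  show ?case by (simp add: harvest_def pencil_def)
next
  case (Suc t)
  have fin: "finite (harvest J d j L t I)"
    using harvest_subset[OF assms(2)] assms(1) by (rule finite_subset)
  have "j \<noteq> i" using assms(3,4) by auto
  from assms(2) show ?case
  proof (cases rule: harvest_Suc_cases[of I j J d L t])
    case unchanged
    then show ?thesis using Suc by simp
  next
    case (pick v)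
    then show ?thesis using card_pencil_absorb_le[OF fin Suc assms(3) \<open>j \<noteq> i\<close>] by simp
  qed
qed

lemma card_harvest_ge:
  assumes "finite L" "finite I" "(j, y) \<in> I"
  shows "t * card (pencil (available J d L (harvest J d j L t I)) j y) \<le> card (harvest J d j L t I)"
proof (induction t)
  case 0
  show ?case by simp
next
  case (Suc t)
  define L' where "L' = harvest J d j L t I"
  define A where "A = available J d L L'"
  have finA: "finite A" using assms(1) finite_subset available_subset unfolding A_def by metis
  have finL': "finite L'"
    unfolding L'_def using harvest_subset[OF assms(2)] assms(1) by (rule finite_subset)
  from assms(2) show ?case
  proof (cases rule: harvest_Suc_cases[of I j J d L t])
    case unchanged
    then show ?thesis using assms(3) by auto
  next
    case (pick v)
    note pick = pick[folded L'_def, folded A_def]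
    have disj: "L' \<inter> pencil A j v = {}" by (auto simp: pencil_def A_def available_def)
    have "available J d L (L' \<union> pencil A j v) \<subseteq> A"
      using available_antimono[of "L' \<union> pencil A j v" L' J d L] finL' finA
      by (simp add: finite_pencil flip: A_def)
    then have "card (pencil (available J d L (L' \<union> pencil A j v)) j y) \<le> card (pencil A j y)"
      by (rule card_pencil_mono[OF finA])
    then have "Suc t * card (pencil (available J d L (L' \<union> pencil A j v)) j y)
        \<le> Suc t * card (pencil A j y)"
      by (rule mult_le_mono2)
    also have "\<dots> \<le> card L' + card (pencil A j v)"
      using pick(2)[OF assms(3)] Suc unfolding L'_def A_def by simp
    also have "\<dots> = card (L' \<union> pencil A j v)"
      using disj finL' finA by (simp add: card_Un_disjoint finite_pencil)
    finally show ?thesis using pick(3) by simp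
  qed
qed

lemma card_unavailable_le:
  assumes "finite L" "L' \<subseteq> L" "finite J" and deg: "\<And>i y. i \<in> J \<Longrightarrow> card (pencil L i y) \<le> R * d"
  shows "card (L - available J d L L') \<le> card L' * (1 + card J * R)"
proof -
  define Z where "Z i = {l \<in> L. d \<le> card (pencil L' i (height i l))}" for i
  have finL': "finite L'" using assms(1,2) by (rule finite_subset[rotated])
  have Z: "card (Z i) \<le> card L' * R" if "i \<in> J" for i
  proof -
    have "card (pencil (Z i) i y) \<le> R * d" for y
      using deg[OF that, of y] card_pencil_mono[OF assms(1), of "Z i" i y] by (simp add: Z_def)
    then have "card (Z i) \<le> card (height i ` Z i) * (R * d)"
      using assms(1) by (intro card_le_heights_mult) (simp_all add: Z_def)
    also have "\<dots> = card (height i ` Z i) * d * R" by simp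
    also have "\<dots> \<le> card L' * R"
      by (intro mult_le_mono1 card_mult_le_of_pencils[OF finL', where j = i]) (auto simp: Z_def)
    finally show ?thesis .
  qed
  have "L - available J d L L' \<subseteq> L' \<union> (\<Union>i\<in>J. Z i)" by (auto simp: available_def Z_def not_less)
  then have "card (L - available J d L L') \<le> card (L' \<union> (\<Union>i\<in>J. Z i))"
    using assms(1,3) finL' by (intro card_mono) (auto simp: Z_def)
  also have "\<dots> \<le> card L' + card (\<Union>i\<in>J. Z i)" by (rule card_Un_le)
  also have "card (\<Union>i\<in>J. Z i) \<le> (\<Sum>i\<in>J. card (Z i))" by (rule card_UN_le[OF assms(3)])
  also have "\<dots> \<le> card J * (card L' * R)"
    using sum_bounded_above[of J "\<lambda>i. card (Z i)" "card L' * R"] Z by simp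
  finally show ?thesis by (simp add: algebra_simps)
qed

section \<open>Passing through the columns\<close>

definition spread :: "real \<Rightarrow> nat \<Rightarrow> nat \<Rightarrow> 'c set \<Rightarrow> 'l set \<Rightarrow> bool" where
  "spread b n d J L \<longleftrightarrow> finite L \<and> b * real n * real d \<le> real (card L) \<and>
     (\<forall>j\<in>J. card (height j ` L) \<le> n \<and> (\<forall>y. card (pencil L j y) \<le> d))"

definition excludes :: "real \<Rightarrow> 'c set \<Rightarrow> 'l set \<Rightarrow> (('c \<times> 'v) set \<Rightarrow> ('c \<times> 'v) set) \<Rightarrow> bool" where
  "excludes c J L W \<longleftrightarrow> (\<forall>I. finite I \<and> (\<forall>l\<in>L. \<not> trace J l \<subseteq> I) \<longrightarrow>
     W I \<subseteq> (\<Union>l\<in>L. trace J l) \<and> W I \<inter> I = {} \<and> c \<le> real (card (W I)))"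

lemma excludesD:
  assumes "excludes c J L W" "finite I" "\<And>l. l \<in> L \<Longrightarrow> \<not> trace J l \<subseteq> I"
  shows "W I \<subseteq> (\<Union>l\<in>L. trace J l)" "W I \<inter> I = {}" "c \<le> real (card (W I))"
  using assms unfolding excludes_def by blast+

lemma spread_harvest:
  assumes "spread b n d' (insert j J) L" "j \<notin> J" "finite I"
    and "b' * real n * real d \<le> real (card (harvest J d j L t I))"
  shows "spread b' n d J (harvest J d j L t I)"
  unfolding spread_def
proof (intro conjI ballI allI assms(4))
  have finL: "finite L" using assms(1) by (simp add: spread_def)
  have sub: "harvest J d j L t I \<subseteq> L" by (rule harvest_subset[OF assms(3)])
  then show "finite (harvest J d j L t I)" using finL by (rule finite_subset)
  fix i assume i: "i \<in> J"
  have "card (height i ` harvest J d j L t I) \<le> card (height i ` L)"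
    using finL sub by (intro card_mono image_mono) simp_all
  also have "\<dots> \<le> n" using assms(1) i by (simp add: spread_def)
  finally show "card (height i ` harvest J d j L t I) \<le> n" .
  show "card (pencil (harvest J d j L t I) i y) \<le> d" for y
    by (rule card_pencil_harvest_le[OF finL assms(3) i assms(2)])
qed

text \<open>
  A popular point of \<open>I\<close> left over would mean that all \<open>t\<close> picks were popular, so the harvest would
  be large.
\<close>
lemma popular_disjoint:
  assumes "finite L" "finite I" "real (card (harvest J d j L t I)) < real t * \<theta>"
  shows "Pair j ` popular \<theta> (available J d L (harvest J d j L t I)) j \<inter> I = {}"
proof -
  have False if "(j, y) \<in> I" "y \<in> popular \<theta> (available J d L (harvest J d j L t I)) j" for y
  proof -
    have "real t * \<theta> \<le> real t * real (card (pencil (available J d L (harvest J d j L t I)) j y))"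
      using that(2) by (intro mult_left_mono) (simp_all add: popular_def)
    also have "\<dots> \<le> real (card (harvest J d j L t I))"
      using card_harvest_ge[OF assms(1,2) that(1), of t J d] by (simp flip: of_nat_mult)
    finally show False using assms(3) by simp
  qed
  then show ?thesis by blast
qed

lemma harvest_meets_no_full_trace:
  assumes "finite I" "l \<in> harvest J d j L t I" "\<And>l. l \<in> L \<Longrightarrow> \<not> trace (insert j J) l \<subseteq> I"
  shows "\<not> trace J l \<subseteq> I"
proof -
  have "l \<in> L" using harvest_subset[OF assms(1)] assms(2) by blast
  then show ?thesis using assms(3)[of l] harvest_incident[OF assms(1,2)] by (auto simp: trace_def)
qed

lemma excludes_single_column:
  assumes "spread b n 1 {j} L" "0 \<le> b"
  shows "excludes (b * real n / 4) {j} L (\<lambda>_. \<Union>l\<in>L. trace {j} l)"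
  unfolding excludes_def
proof (intro allI impI conjI)
  show "(\<Union>l\<in>L. trace {j} l) \<inter> I = {}" if "finite I \<and> (\<forall>l\<in>L. \<not> trace {j} l \<subseteq> I)" for I
    using that by (auto simp: trace_def)
  have "card L \<le> card (height j ` L) * 1"
    using assms(1) by (intro card_le_heights_mult) (simp_all add: spread_def)
  moreover have "(\<Union>l\<in>L. trace {j} l) = Pair j ` height j ` L" by (auto simp: trace_def)
  then have "card (\<Union>l\<in>L. trace {j} l) = card (height j ` L)" by (simp add: card_image inj_on_def)
  moreover have "0 \<le> b * real n" using assms(2) by simp
  ultimately show "b * real n / 4 \<le> real (card (\<Union>l\<in>L. trace {j} l))"
    using assms(1) by (simp add: spread_def)
qed simp

context
  fixes n R f k :: nat
  assumes R_pos: "0 < R" and column_size: "n \<le> f * R"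
begin

lemma card_unavailable_spread_le:
  assumes L: "spread b n (R * d) (insert j J) L" "L' \<subseteq> L" and J: "finite J" "Suc (card J) \<le> k"
    and small: "4 * real k * real (card L') \<le> b * real n * real d"
  shows "real (card (L - available J d L L')) \<le> b * real n * real (R * d) / 4"
proof -
  have "card (L - available J d L L') \<le> card L' * (1 + card J * R)"
    using L by (intro card_unavailable_le J(1)) (simp_all add: spread_def)
  also have "1 + card J * R \<le> Suc (card J) * R" using R_pos by simp
  also have "\<dots> \<le> k * R" by (rule mult_le_mono1[OF J(2)])
  finally have "card (L - available J d L L') \<le> card L' * (k * R)" by simp
  then have "real (card (L - available J d L L')) \<le> real (card L' * (k * R))"
    by (simp only: of_nat_le_iff)
  also have "\<dots> = 4 * real k * real (card L') * real R / 4" by simp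
  also have "\<dots> \<le> b * real n * real d * real R / 4"
    using small by (intro divide_right_mono mult_right_mono) simp_all
  finally show ?thesis by (simp add: mult_ac)
qed

lemma card_popular_available_ge:
  assumes L: "spread b n (R * d) (insert j J) L" "L' \<subseteq> L" and J: "finite J" "Suc (card J) \<le> k"
    and pos: "0 < b" "0 < d"
    and small: "4 * real k * real (card L') \<le> b * real n * real d"
  shows "b * real n / 4 \<le> real (card (popular (b * real (R * d) / 2) (available J d L L') j))"
proof -
  define A where "A = available J d L L'"
  define \<theta> where "\<theta> = b * real (R * d) / 2"
  define D where "D = real (R * d)"
  have \<theta>: "0 < \<theta>" and D: "0 < D" using pos R_pos by (simp_all add: \<theta>_def D_def)
  have finL: "finite L" using L(1) by (simp add: spread_def)
  have A: "A \<subseteq> L" unfolding A_def by (rule available_subset)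
  have finA: "finite A" using A finL by (rule finite_subset)
  have "card (height j ` A) \<le> card (height j ` L)"
    using finL A by (intro card_mono image_mono) simp_all
  then have heights: "card (height j ` A) \<le> n" using L(1) by (simp add: spread_def)
  have "card (pencil A j y) \<le> R * d" for y
    using card_pencil_mono[OF finL A, of j y] L(1) by (auto simp: spread_def intro: order_trans)
  then have "real (card (pencil A j y)) \<le> D" for y
    unfolding D_def by (simp only: of_nat_le_iff)
  then have "real (card A) \<le> real (card (popular \<theta> A j)) * D + real (card (height j ` A)) * \<theta>"
    using \<theta> by (intro card_le_popular finA)
  also have "\<dots> \<le> real (card (popular \<theta> A j)) * D + real n * \<theta>"
    using heights \<theta> by simp
  finally have available: "real (card A) \<le> real (card (popular \<theta> A j)) * D + b * real n * D / 2"
    by (simp add: \<theta>_def D_def mult_ac)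
  have "b * real n * D \<le> real (card L)" using L(1) by (simp add: spread_def D_def)
  also have "\<dots> = real (card (L - A)) + real (card A)"
    using card_Diff_subset[OF finA A] card_mono[OF finL A] by simp
  also have "real (card (L - A)) \<le> b * real n * D / 4"
    unfolding A_def D_def by (rule card_unavailable_spread_le[OF L J small])
  finally have "b * real n / 4 * D \<le> real (card (popular \<theta> A j)) * D"
    using available by simp
  then show ?thesis using D by (simp add: \<theta>_def A_def)
qed

definition exclude_column :: "real \<Rightarrow> nat \<Rightarrow> 'c set \<Rightarrow> 'c \<Rightarrow> 'l set \<Rightarrow>
    ('l set \<Rightarrow> ('c \<times> 'v) set \<Rightarrow> ('c \<times> 'v) set) \<Rightarrow> ('c \<times> 'v) set \<Rightarrow> ('c \<times> 'v) set" where
  "exclude_column b d J j L W I = (let L' = harvest J d j L f I in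
     if spread (b / (4 * real k)) n d J L' then W L' I
     else Pair j ` popular (b * real (R * d) / 2) (available J d L L') j)"

lemma determined_exclude_column:
  assumes "\<And>L'. determined t (W L')"
  shows "determined (f + t) (exclude_column b d J j L W)"
proof -
  define B where "B L' I = (if spread (b / (4 * real k)) n d J L' then W L' I
    else Pair j ` popular (b * real (R * d) / 2) (available J d L L') j)" for L' I
  have "determined t (B L')" for L'
    unfolding B_def[abs_def]
    by (cases "spread (b / (4 * real k)) n d J L'") (simp_all add: assms determined_const)
  then have "determined (f + t) (\<lambda>I. B (harvest J d j L f I) I)"
    by (intro determined_bind determined_harvest)
  then show ?thesis by (simp add: exclude_column_def[abs_def] B_def Let_def)
qed

lemma popular_points_excluded:
  assumes L: "spread b n (R * d) (insert j J) L" and J: "finite J" "Suc (card J) \<le> k"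
    and pos: "0 < b" "0 < d" and finI: "finite I"
    and small: "4 * real k * real (card (harvest J d j L f I)) < b * real n * real d"
  defines "Y \<equiv> popular (b * real (R * d) / 2) (available J d L (harvest J d j L f I)) j"
  shows "Pair j ` Y \<subseteq> (\<Union>l\<in>L. trace (insert j J) l)" "Pair j ` Y \<inter> I = {}"
    "b * real n / 4 \<le> real (card (Pair j ` Y))"
proof -
  define L' where "L' = harvest J d j L f I"
  have finL: "finite L" using L by (simp add: spread_def)
  have sub: "L' \<subseteq> L" unfolding L'_def by (rule harvest_subset[OF finI])
  have "Y \<subseteq> height j ` available J d L L'"
    unfolding Y_def L'_def using pos R_pos by (intro popular_subset) simp
  then show "Pair j ` Y \<subseteq> (\<Union>l\<in>L. trace (insert j J) l)"
    using available_subset[of J d L L'] by (fastforce simp: trace_def)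
  have "1 * real (card L') \<le> 2 * real k * real (card L')"
    using J(2) by (intro mult_right_mono) simp_all
  also have "\<dots> < b * real n * real d / 2" using small by (simp add: L'_def)
  also have "\<dots> \<le> b * real (f * R) * real d / 2"
    using column_size pos
    by (intro divide_right_mono mult_right_mono mult_left_mono) (simp_all del: of_nat_mult)
  also have "\<dots> = real f * (b * real (R * d) / 2)" by simp
  finally show "Pair j ` Y \<inter> I = {}"
    unfolding Y_def L'_def by (intro popular_disjoint finL finI) simp
  have "card (Pair j ` Y) = card Y" by (simp add: card_image inj_on_def)
  then show "b * real n / 4 \<le> real (card (Pair j ` Y))"
    using card_popular_available_ge[OF L sub J pos] small by (simp add: Y_def L'_def)
qed

lemma excludes_exclude_column:
  assumes L: "spread b n (R * d) (insert j J) L"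
    and J: "j \<notin> J" "finite J" "Suc (card J) \<le> k"
    and pos: "0 < b" "0 < d"
    and W: "\<And>L'. spread (b / (4 * real k)) n d J L' \<Longrightarrow> excludes c J L' (W L')"
    and bound: "c \<le> b * real n / 4"
  shows "excludes c (insert j J) L (exclude_column b d J j L W)"
  unfolding excludes_def
proof (intro allI impI)
  fix I assume "finite I \<and> (\<forall>l\<in>L. \<not> trace (insert j J) l \<subseteq> I)"
  then have finI: "finite I" and free: "\<And>l. l \<in> L \<Longrightarrow> \<not> trace (insert j J) l \<subseteq> I" by auto
  let ?W = "exclude_column b d J j L W I"
  define L' where "L' = harvest J d j L f I"
  show "?W \<subseteq> (\<Union>l\<in>L. trace (insert j J) l) \<and> ?W \<inter> I = {} \<and> c \<le> real (card ?W)"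
  proof (cases "spread (b / (4 * real k)) n d J L'")
    case True
    have "\<not> trace J l \<subseteq> I" if "l \<in> L'" for l
      using finI that free unfolding L'_def by (rule harvest_meets_no_full_trace)
    note W' = excludesD[OF W[OF True] finI this]
    have "(\<Union>l\<in>L'. trace J l) \<subseteq> (\<Union>l\<in>L. trace (insert j J) l)"
      unfolding L'_def using harvest_subset[OF finI] by (intro UN_mono trace_mono) auto
    moreover have "?W = W L' I" using True by (simp add: exclude_column_def L'_def Let_def)
    ultimately show ?thesis using W' by simp
  next
    case False
    then have "real (card L') < b / (4 * real k) * real n * real d"
      unfolding L'_def
      using spread_harvest[OF L J(1) finI, of "b / (4 * real k)" d f] by (metis not_le)
    then have "4 * real k * real (card L') < b * real n * real d"
      using J(3) by (simp add: field_simps)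
    note Y = popular_points_excluded[OF L J(2,3) pos finI this[unfolded L'_def]]
    show ?thesis using False Y bound by (simp add: exclude_column_def L'_def Let_def)
  qed
qed

lemma excluded_set_exists:
  assumes "card J = Suc r" "Suc r \<le> k" "0 < b" "spread b n (R ^ r) J L"
  shows "\<exists>W. determined (r * f) W \<and> excludes (b * real n / 4 / real (4 * k) ^ r) J L W"
  using assms
proof (induction r arbitrary: J L b)
  case 0
  obtain j where "J = {j}" using "0.prems"(1) by (metis One_nat_def card_1_singletonE)
  then show ?case
    using excludes_single_column[of b n j L] "0.prems"(3,4)
    by (intro exI[of _ "\<lambda>_. \<Union>l\<in>L. trace J l"]) (simp add: determined_const)
next
  case (Suc r)
  note k = Suc.prems(2) and b = Suc.prems(3)
  obtain j J' where J: "J = insert j J'" "j \<notin> J'" "card J' = Suc r"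
    using Suc.prems(1) by (metis card_Suc_eq)
  have finJ': "finite J'" using J(3) by (simp add: card_ge_0_finite)
  let ?b = "b / (4 * real k)" and ?c = "b * real n / 4 / real (4 * k) ^ Suc r"
  have "\<exists>W. determined (r * f) W \<and> (spread ?b n (R ^ r) J' L' \<longrightarrow> excludes ?c J' L' W)" for L'
  proof (cases "spread ?b n (R ^ r) J' L'")
    case True
    then have "\<exists>W. determined (r * f) W \<and> excludes (?b * real n / 4 / real (4 * k) ^ r) J' L' W"
      using k b by (intro Suc.IH J(3)) simp_all
    moreover have "?b * real n / 4 / real (4 * k) ^ r = ?c" by simp
    ultimately show ?thesis by metis
  next
    case False
    then show ?thesis using determined_const[of "r * f" "{}"] by blast
  qed
  then obtain W where detW: "\<And>L'. determined (r * f) (W L')"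
    and W: "\<And>L'. spread ?b n (R ^ r) J' L' \<Longrightarrow> excludes ?c J' L' (W L')"
    by metis
  have "1 \<le> real (4 * k) ^ Suc r" using k by (intro one_le_power) simp
  then have "?c \<le> b * real n / 4 / 1" using b k by (intro divide_left_mono) simp_all
  then have "excludes ?c J L (exclude_column b (R ^ r) J' j L W)"
    unfolding J(1) using Suc.prems(4) J(1,3) k R_pos
    by (intro excludes_exclude_column J(2) finJ' b W) simp_all
  moreover have "determined (f + r * f) (exclude_column b (R ^ r) J' j L W)"
    by (rule determined_exclude_column[OF detW])
  ultimately show ?case
    by (intro exI[of _ "exclude_column b (R ^ r) J' j L W"]) simp
qed

end

end

section \<open>Supersaturation and containers for line-free sets\<close>

lemma ex_card_UN_le_mult:
  assumes "finite A" "A \<noteq> {}"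
  shows "\<exists>x\<in>A. card (\<Union>x\<in>A. G x) \<le> card A * card (G x)"
proof -
  have "Max ((\<lambda>x. card (G x)) ` A) \<in> (\<lambda>x. card (G x)) ` A" using assms by (intro Max_in) auto
  then obtain x where x: "x \<in> A" "card (G x) = Max ((\<lambda>x. card (G x)) ` A)" by auto
  have "card (G y) \<le> card (G x)" if "y \<in> A" for y
    unfolding x(2) using assms(1) that by (intro Max_ge) auto
  then have "(\<Sum>y\<in>A. card (G y)) \<le> card A * card (G x)"
    using sum_bounded_above[of A "\<lambda>y. card (G y)" "card (G x)"] by simp
  then show ?thesis using card_UN_le[OF assms(1), of G] x(1) by (meson order_trans)
qed

locale nearly_regular_line_family = line_system height
  for height :: "'c \<Rightarrow> 'l \<Rightarrow> 'v::wellorder" +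
  fixes X :: "'c set" and V :: "'v set" and L :: "'l set" and d :: nat and \<alpha> :: real
  assumes finite_family: "finite X" "finite V" "finite L"
    and height_mem: "j \<in> X \<Longrightarrow> l \<in> L \<Longrightarrow> height j l \<in> V"
    and degree_le: "j \<in> X \<Longrightarrow> card (pencil L j y) \<le> d"
    and many_lines: "(1 - \<alpha> / 4) * real (card V * d) \<le> real (card L)"
    and density: "0 < \<alpha>" "\<alpha> \<le> 1"
begin

lemma finite_trace: "finite (trace X l)"
  using finite_family(1) by (simp add: trace_def)

lemma card_lines_le:
  assumes "X \<noteq> {}"
  shows "card L \<le> card V * d"
proof -
  obtain j where j: "j \<in> X" using assms by blast
  have "card L \<le> card (height j ` L) * d"
    by (intro card_le_heights_mult finite_family(3) degree_le j)
  also have "\<dots> \<le> card V * d"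
    using height_mem[OF j] by (intro mult_le_mono1 card_mono finite_family(2)) blast
  finally show ?thesis .
qed

lemma card_missed_incidences_le:
  assumes "C \<subseteq> X \<times> V"
  shows "real (card (SIGMA l:L. trace X l - C))
    \<le> (real (card X) * real (card V) - real (card C)) * real d"
proof -
  define Z where "Z = (SIGMA l:L. trace X l - C)"
  have finZ: "finite Z"
    unfolding Z_def using finite_family(3) finite_trace by (intro finite_SigmaI) auto
  have "real (card Z) \<le> real (card (snd ` Z)) * real d"
  proof (intro card_le_card_image_mult finZ)
    fix p :: "'c \<times> 'v"
    obtain j y where p: "p = (j, y)" by fastforce
    have sub: "{z \<in> Z. snd z = p} \<subseteq> (\<lambda>l. (l, p)) ` pencil L j y"
      by (auto simp: p Z_def pencil_def trace_def)
    show "real (card {z \<in> Z. snd z = p}) \<le> real d"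
    proof (cases "j \<in> X")
      case True
      have "card {z \<in> Z. snd z = p} \<le> card (pencil L j y)"
        by (rule surj_card_le[OF finite_pencil[OF finite_family(3)] sub])
      then show ?thesis using degree_le[OF True, of y] by simp
    next
      case False
      then have "{z \<in> Z. snd z = p} = {}" by (auto simp: p Z_def trace_def)
      then show ?thesis by (simp only: card.empty)
    qed
  qed
  also have "real (card (snd ` Z)) \<le> real (card (X \<times> V - C))"
    using height_mem finite_family by (intro of_nat_mono card_mono) (auto simp: Z_def trace_def)
  also have "\<dots> = real (card X) * real (card V) - real (card C)"
    using assms finite_family card_mono[OF _ assms] finite_subset[OF assms]
    by (simp add: card_Diff_subset card_cartesian_product of_nat_diff)
  finally show ?thesis by (simp add: Z_def mult_right_mono)
qed

lemma sum_card_trace_ge: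
  assumes "C \<subseteq> X \<times> V"
  shows "real (card X) * real (card L) - real d * (real (card X) * real (card V) - real (card C))
    \<le> (\<Sum>l\<in>L. real (card (trace X l \<inter> C)))"
proof -
  have "real (card X) * real (card L) = (\<Sum>l\<in>L. real (card (trace X l)))"
    by (simp add: card_trace)
  also have "\<dots> = (\<Sum>l\<in>L. real (card (trace X l \<inter> C)) + real (card (trace X l - C)))"
    using card_Int_Diff[OF finite_trace] by (simp flip: of_nat_add)
  also have "\<dots> = (\<Sum>l\<in>L. real (card (trace X l \<inter> C))) + real (card (SIGMA l:L. trace X l - C))"
    using finite_family(3) finite_trace by (simp add: sum.distrib)
  finally show ?thesis
    using card_missed_incidences_le[OF assms] by (simp add: mult.commute)
qed

lemma card_rich_lines_ge:
  assumes C: "C \<subseteq> X \<times> V" "\<alpha> * real (card X) * real (card V) \<le> real (card C)"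
    and k: "4 * real k \<le> \<alpha> * real (card X)" "0 < card X"
  shows "\<alpha> / 2 * real (card V) * real d \<le> real (card {l \<in> L. k \<le> card (trace X l \<inter> C)})"
    (is "_ \<le> real (card ?rich)")
proof -
  define M n :: real where "M = real (card X)" and "n = real (card V)"
  have M: "0 < M" using k(2) by (simp add: M_def)
  have L: "real (card L) \<le> n * real d"
    using card_lines_le k(2) unfolding n_def by (simp flip: of_nat_mult) fastforce
  have "(1 - \<alpha> / 4) * (n * real d) * M - real d * (M * n - \<alpha> * M * n)
      \<le> real (card L) * M - real d * (M * n - real (card C))"
    using many_lines C(2) M unfolding n_def M_def
    by (intro diff_mono mult_right_mono mult_left_mono diff_left_mono) simp_all
  also have "\<dots> \<le> (\<Sum>l\<in>L. real (card (trace X l \<inter> C)))"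
    using sum_card_trace_ge[OF C(1)] by (simp add: M_def n_def mult.commute)
  also have "\<dots> \<le> (\<Sum>l\<in>L. (if l \<in> ?rich then M else 0) + real k)"
  proof (intro sum_mono)
    fix l assume "l \<in> L"
    moreover have "card (trace X l \<inter> C) \<le> card X"
      using card_mono[OF finite_trace, of "trace X l \<inter> C" l] by (simp add: card_trace)
    ultimately show "real (card (trace X l \<inter> C)) \<le> (if l \<in> ?rich then M else 0) + real k"
      by (auto simp: M_def)
  qed
  also have "\<dots> = real (card ?rich) * M + real (card L) * real k"
    using finite_family(3) by (simp add: sum.distrib sum.If_cases Int_def)
  also have "real (card L) * real k \<le> n * real d * (\<alpha> * M / 4)"
    using L k(1) by (intro mult_mono) (simp_all add: M_def n_def)
  finally have "\<alpha> / 2 * n * real d * M \<le> real (card ?rich) * M" by (simp add: algebra_simps)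
  then show ?thesis using M by (simp add: n_def)
qed

lemma dense_set_has_popular_columns:
  assumes C: "C \<subseteq> X \<times> V" "\<alpha> * real (card X) * real (card V) \<le> real (card C)"
    and k: "4 * real k \<le> \<alpha> * real (card X)" "0 < card X"
  shows "\<exists>J\<subseteq>X. card J = k \<and>
    \<alpha> / 2 / 2 ^ card X * real (card V) * real d \<le> real (card {l \<in> L. trace J l \<subseteq> C})"
proof -
  define \<J> where "\<J> = {J. J \<subseteq> X \<and> card J = k}"
  have "\<alpha> * real (card X) \<le> 1 * real (card X)" using density(2) by (rule mult_right_mono) simp
  then have "k \<le> card X" using k(1) by simp
  then have ne: "\<J> \<noteq> {}" using obtain_subset_with_card_n[of k X] unfolding \<J>_def by blast
  have fin: "finite \<J>" using finite_family(1) by (simp add: \<J>_def)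
  have "card \<J> \<le> card (Pow X)" unfolding \<J>_def using finite_family(1) by (intro card_mono) auto
  then have card: "card \<J> \<le> 2 ^ card X" using finite_family(1) by (simp add: card_Pow)
  have "\<exists>J\<in>\<J>. trace J l \<subseteq> C" if "k \<le> card (trace X l \<inter> C)" for l
    using ex_full_trace[OF that] by (auto simp: \<J>_def)
  then have "{l \<in> L. k \<le> card (trace X l \<inter> C)} \<subseteq> (\<Union>J\<in>\<J>. {l \<in> L. trace J l \<subseteq> C})" by blast
  then have "card {l \<in> L. k \<le> card (trace X l \<inter> C)} \<le> card (\<Union>J\<in>\<J>. {l \<in> L. trace J l \<subseteq> C})"
    using fin finite_family(3) by (intro card_mono) auto
  also obtain J where J: "J \<in> \<J>"
    "card (\<Union>J\<in>\<J>. {l \<in> L. trace J l \<subseteq> C}) \<le> card \<J> * card {l \<in> L. trace J l \<subseteq> C}"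
    using ex_card_UN_le_mult[OF fin ne] by blast
  note J(2)
  also have "card \<J> * card {l \<in> L. trace J l \<subseteq> C} \<le> 2 ^ card X * card {l \<in> L. trace J l \<subseteq> C}"
    by (rule mult_le_mono1[OF card])
  finally have "real (card {l \<in> L. k \<le> card (trace X l \<inter> C)})
      \<le> real (2 ^ card X * card {l \<in> L. trace J l \<subseteq> C})"
    by (simp only: of_nat_le_iff)
  then have "\<alpha> / 2 * real (card V) * real d \<le> 2 ^ card X * real (card {l \<in> L. trace J l \<subseteq> C})"
    using card_rich_lines_ge[OF C k] by simp
  then have "\<alpha> / 2 / 2 ^ card X * real (card V) * real d \<le> real (card {l \<in> L. trace J l \<subseteq> C})"
    by (simp add: field_simps)
  then show ?thesis using J(1) unfolding \<J>_def by blast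
qed

definition shrinkage :: "nat \<Rightarrow> real" where
  "shrinkage k = \<alpha> / 2 / 2 ^ card X / 4 / real (4 * k) ^ (k - 1)"

lemma spread_full_lines:
  assumes "J \<subseteq> X" "b * real (card V) * real d \<le> real (card {l \<in> L. trace J l \<subseteq> C})"
  shows "spread b (card V) d J {l \<in> L. trace J l \<subseteq> C}"
  unfolding spread_def
proof (intro conjI ballI allI assms(2))
  show "finite {l \<in> L. trace J l \<subseteq> C}" using finite_family(3) by simp
  fix j assume "j \<in> J"
  then have j: "j \<in> X" using assms(1) by blast
  then show "card (height j ` {l \<in> L. trace J l \<subseteq> C}) \<le> card V"
    using height_mem finite_family(2) by (intro card_mono) auto
  have "card (pencil {l \<in> L. trace J l \<subseteq> C} j y) \<le> card (pencil L j y)" for y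
    using finite_family(3) by (rule card_pencil_mono) simp
  then show "card (pencil {l \<in> L. trace J l \<subseteq> C} j y) \<le> d" for y
    using degree_le[OF j] by (rule order_trans)
qed

lemma line_free_trace_not_subset:
  assumes "line_free X L k I" "J \<subseteq> X" "card J = k" "l \<in> L"
  shows "\<not> trace J l \<subseteq> I"
proof
  assume "trace J l \<subseteq> I"
  then have "card (trace J l) \<le> card (trace X l \<inter> I)"
    using trace_mono[OF assms(2)] finite_trace by (intro card_mono) auto
  moreover have "card (trace X l \<inter> I) < k" using assms(1,4) by (simp add: line_free_def)
  ultimately show False by (simp add: card_trace assms(3))
qed

lemma container_map_Diff_excluded:
  assumes C: "finite C" and J: "J \<subseteq> X" "card J = k"
    and W: "determined t W" "excludes c J {l \<in> L. trace J l \<subseteq> C} W"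
  shows "container_map (line_free X L k) t (real (card C) - c) C (\<lambda>I. C - W I)"
  unfolding container_map_def
proof (intro conjI allI impI)
  show "determined t (\<lambda>I. C - W I)" using W(1) by (rule determined_comp)
  fix I assume I: "I \<subseteq> C" "line_free X L k I"
  have "\<not> trace J l \<subseteq> I" if "l \<in> {l \<in> L. trace J l \<subseteq> C}" for l
    using line_free_trace_not_subset[OF I(2) J] that by simp
  note excluded = excludesD[OF W(2) finite_subset[OF I(1) C] this]
  have "W I \<subseteq> C" using excluded(1) by auto
  then have "real (card (C - W I)) = real (card C) - real (card (W I))"
    using C by (simp add: card_Diff_subset finite_subset card_mono of_nat_diff)
  then show "I \<subseteq> C - W I" "C - W I \<subseteq> C" "real (card (C - W I)) \<le> real (card C) - c"
    using excluded(2,3) I(1) by auto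
qed

lemma line_free_container_step:
  assumes C: "C \<subseteq> X \<times> V" "\<alpha> * real (card X) * real (card V) \<le> real (card C)"
    and k: "0 < k" "4 * real k \<le> \<alpha> * real (card X)"
    and R: "d = R ^ (k - 1)" "0 < R" "card V \<le> f * R"
  shows "\<exists>A. container_map (line_free X L k) ((k - 1) * f)
    (real (card C) - shrinkage k * real (card V)) C A"
proof -
  let ?b = "\<alpha> / 2 / 2 ^ card X"
  have "0 < card X" using k density by (cases "card X = 0") auto
  from dense_set_has_popular_columns[OF C k(2) this]
  obtain J where J: "J \<subseteq> X" "card J = k"
    and full: "?b * real (card V) * real d \<le> real (card {l \<in> L. trace J l \<subseteq> C})" by blast
  have "card J = Suc (k - 1)" "Suc (k - 1) \<le> k" "0 < ?b" using J(2) k(1) density by simp_all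
  from excluded_set_exists[OF R(2,3) this spread_full_lines[OF J(1) full, unfolded R(1)]]
  obtain W where "determined ((k - 1) * f) W"
    "excludes (shrinkage k * real (card V)) J {l \<in> L. trace J l \<subseteq> C} W"
    unfolding shrinkage_def by (auto simp: mult_ac)
  moreover have "finite C" using C(1) finite_family by (meson finite_SigmaI finite_subset)
  ultimately show ?thesis using container_map_Diff_excluded[OF _ J] by blast
qed

theorem line_free_containers:
  assumes k: "0 < k" "4 * real k \<le> \<alpha> * real (card X)"
    and R: "d = R ^ (k - 1)" "0 < R" "card V \<le> f * R"
    and n: "real (card X) \<le> real n * shrinkage k"
  shows "\<exists>A. container_map (line_free X L k) (n * ((k - 1) * f))
    (\<alpha> * real (card X) * real (card V)) (X \<times> V) A"
proof -
  let ?c = "\<alpha> * real (card X) * real (card V)" and ?\<delta> = "shrinkage k * real (card V)"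
  have "0 \<le> ?\<delta>" using density by (simp add: shrinkage_def)
  then have "\<exists>A. container_map (line_free X L k) (n * ((k - 1) * f))
      (max ?c (real (card (X \<times> V)) - real n * ?\<delta>)) (X \<times> V) A"
    by (rule container_map_iterate) (rule line_free_container_step[OF _ _ k R])
  moreover have "real (card X) * real (card V) \<le> real n * shrinkage k * real (card V)"
    using n by (intro mult_right_mono) simp_all
  then have "real (card (X \<times> V)) - real n * ?\<delta> \<le> 0" by (simp add: card_cartesian_product mult_ac)
  moreover have "0 \<le> ?c" using density by simp
  ultimately show ?thesis by (simp add: max_absorb1)
qed

end

section \<open>Sparse random samples\<close>

definition sample :: "'i set \<Rightarrow> 'p set \<Rightarrow> ('i \<Rightarrow> 'p) pmf" where
  "sample A P = pmf_of_set (A \<rightarrow>\<^sub>E P)"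

lemma set_pmf_sample:
  assumes "finite A" "finite P" "P \<noteq> {}"
  shows "set_pmf (sample A P) = A \<rightarrow>\<^sub>E P"
  unfolding sample_def using assms
  by (intro set_pmf_of_set finite_PiE) (auto simp: PiE_eq_empty_iff)

lemma prob_bex_le_sum:
  assumes "finite T"
  shows "measure_pmf.prob p {x. \<exists>t\<in>T. E t x} \<le> (\<Sum>t\<in>T. measure_pmf.prob p {x. E t x})"
proof -
  have "{x. \<exists>t\<in>T. E t x} = (\<Union>t\<in>T. {x. E t x})" by blast
  then show ?thesis
    using measure_pmf.finite_measure_subadditive_finite[OF assms, of "\<lambda>t. {x. E t x}" p] by simp
qed

lemma prob_bex_le_card_mult:
  assumes "finite T" "\<And>t. t \<in> T \<Longrightarrow> measure_pmf.prob p {x. E t x} \<le> q"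
  shows "measure_pmf.prob p {x. \<exists>t\<in>T. E t x} \<le> real (card T) * q"
  using prob_bex_le_sum[OF assms(1), of p E] sum_bounded_above[OF assms(2)] by fastforce

lemma card_PiE_fixed_le:
  fixes \<rho> :: real
  assumes fin: "finite A" "finite P" and JK: "J \<subseteq> A" "K \<subseteq> A" "J \<inter> K = {}"
    and G: "real (card (G \<inter> P)) \<le> \<rho> * real (card P)"
  shows "real (card (PiE A (\<lambda>i. if i \<in> J then {u i} else if i \<in> K then G \<inter> P else P)))
    \<le> \<rho> ^ card K * real (card P) ^ (card A - card J)"
proof -
  have finJK: "finite J" "finite K" using JK fin(1) by (auto intro: finite_subset)
  have J: "A \<inter> J = J" and K: "A \<inter> - J \<inter> K = K" and rest: "A \<inter> - J \<inter> - K = A - J - K"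
    using JK by auto
  have "card (A - J) = card K + card (A - J - K)"
    using card_Int_Diff[of "A - J" K] K fin(1) by (simp add: Diff_eq)
  then have split: "card A - card J = card K + card (A - J - K)"
    using JK(1) fin(1) finJK by (simp add: card_Diff_subset)
  have "real (card (PiE A (\<lambda>i. if i \<in> J then {u i} else if i \<in> K then G \<inter> P else P)))
      = (\<Prod>i\<in>A. if i \<in> J then 1 else if i \<in> K then real (card (G \<inter> P)) else real (card P))"
    using fin(1) by (simp add: card_PiE if_distrib[of card] if_distrib[of real] cong: if_cong)
  also have "\<dots> = real (card (G \<inter> P)) ^ card K * real (card P) ^ card (A - J - K)"
    using fin(1) by (simp add: prod.If_cases J K rest)
  also have "\<dots> \<le> (\<rho> * real (card P)) ^ card K * real (card P) ^ card (A - J - K)"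
    using G by (intro mult_right_mono power_mono) auto
  also have "\<dots> = \<rho> ^ card K * real (card P) ^ (card A - card J)"
    by (simp add: split power_mult_distrib power_add)
  finally show ?thesis .
qed

text \<open>Conditioned on the values on \<open>J\<close>, those on \<open>K\<close> are still uniform.\<close>
lemma prob_adaptive_event_le:
  fixes \<rho> :: real
  assumes fin: "finite A" "finite P" "P \<noteq> {}" and JK: "J \<subseteq> A" "K \<subseteq> A" "J \<inter> K = {}"
    and G: "\<And>u. real (card (G u \<inter> P)) \<le> \<rho> * real (card P)"
  shows "measure_pmf.prob (sample A P) {h. \<forall>i\<in>K. h i \<in> G (restrict h J)} \<le> \<rho> ^ card K"
proof -
  let ?E = "(A \<rightarrow>\<^sub>E P) \<inter> {h. \<forall>i\<in>K. h i \<in> G (restrict h J)}"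
  define B where "B u = PiE A (\<lambda>i. if i \<in> J then {u i} else if i \<in> K then G u \<inter> P else P)" for u
  have finJ: "finite J" using JK(1) fin(1) by (rule finite_subset)
  have finB: "finite (B u)" for u
    unfolding B_def using fin by (intro finite_PiE) auto
  have "?E \<subseteq> (\<Union>u \<in> J \<rightarrow>\<^sub>E P. B u)"
  proof
    fix h assume h: "h \<in> ?E"
    then have "restrict h J \<in> J \<rightarrow>\<^sub>E P" using JK(1) by auto
    moreover have "h \<in> B (restrict h J)" using h JK by (auto simp: B_def PiE_iff)
    ultimately show "h \<in> (\<Union>u \<in> J \<rightarrow>\<^sub>E P. B u)" by blast
  qed
  then have "card ?E \<le> card (\<Union>u \<in> J \<rightarrow>\<^sub>E P. B u)"
    using fin finJ finB by (intro card_mono finite_UN_I finite_PiE) auto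
  also have "\<dots> \<le> (\<Sum>u \<in> J \<rightarrow>\<^sub>E P. card (B u))"
    using fin finJ by (intro card_UN_le finite_PiE) auto
  finally have "real (card ?E) \<le> (\<Sum>u \<in> J \<rightarrow>\<^sub>E P. real (card (B u)))" by (simp flip: of_nat_sum)
  also have "\<dots> \<le> real (card (J \<rightarrow>\<^sub>E P)) * (\<rho> ^ card K * real (card P) ^ (card A - card J))"
    unfolding B_def by (intro sum_bounded_above card_PiE_fixed_le fin JK G)
  also have "\<dots> = \<rho> ^ card K * real (card P) ^ (card J + (card A - card J))"
    using finJ by (simp add: card_PiE power_add)
  also have "card J + (card A - card J) = card A" using card_mono[OF fin(1) JK(1)] by simp
  finally have "real (card ?E) \<le> \<rho> ^ card K * real (card P) ^ card A" .
  moreover have "0 < real (card P) ^ card A" using fin(2,3) by (simp add: card_gt_0_iff)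
  moreover have "measure_pmf.prob (sample A P) {h. \<forall>i\<in>K. h i \<in> G (restrict h J)}
      = real (card ?E) / real (card P) ^ card A"
    unfolding sample_def using fin
    by (subst measure_pmf_of_set) (auto simp: card_PiE PiE_eq_empty_iff intro: finite_PiE)
  ultimately show ?thesis by (simp add: divide_le_eq)
qed

lemma fingerprint_preimages:
  assumes "finite A" "I \<subseteq> h ` A" and F: "F \<subseteq> I" "I \<subseteq> G F" "card F \<le> t" and "u \<le> card I"
  obtains J K where "J \<subseteq> A" "K \<subseteq> A" "J \<inter> K = {}" "u - t \<le> card K" "\<And>i. i \<in> K \<Longrightarrow> h i \<in> G (h ` J)"
proof -
  obtain U where U: "U \<subseteq> A" "inj_on h U" "I = h ` U"
    using assms(2) by (auto simp: subset_image_inj)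
  define J K where "J = {i \<in> U. h i \<in> F}" and "K = {i \<in> U. h i \<notin> F}"
  have image: "h ` J = F" "h ` K = I - F" using F(1) U(3) by (auto simp: J_def K_def)
  have "inj_on h K" using U(2) by (rule inj_on_subset) (auto simp: K_def)
  then have "card K = card (I - F)" using card_image image(2) by metis
  moreover have "finite F" using assms(1,2) F(1) by (meson finite_imageI finite_subset)
  then have "card I - card F \<le> card (I - F)" by (rule diff_card_le_card_Diff)
  ultimately have "u - t \<le> card K" using F(3) assms(6) by linarith
  moreover have "h i \<in> G (h ` J)" if "i \<in> K" for i using that image F(2) by blast
  ultimately show thesis using U(1) by (intro that[of J K]) (auto simp: J_def K_def)
qed

lemma prob_large_subset_le:
  fixes A :: "'i set" and P :: "'p set" and \<rho> :: real
  assumes fin: "finite A" "finite P" "P \<noteq> {}" and \<rho>: "0 \<le> \<rho>" "\<rho> \<le> 1"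
    and containers: "container_map Q t (\<rho> * real (card P)) P C"
  shows "measure_pmf.prob (sample A P) {h. \<exists>I\<subseteq>h ` A. Q I \<and> u \<le> card I} \<le> 4 ^ card A * \<rho> ^ (u - t)"
proof -
  have "0 \<le> \<rho> * real (card P)" using \<rho>(1) by simp
  from container_map_fingerprints[OF containers fin(2) this]
  obtain G where G: "\<And>F. G F \<subseteq> P" "\<And>F. real (card (G F)) \<le> \<rho> * real (card P)"
    "\<And>I. I \<subseteq> P \<Longrightarrow> Q I \<Longrightarrow> \<exists>F\<subseteq>I. card F \<le> t \<and> I \<subseteq> G F" by blast
  define D where "D = {(J, K). J \<subseteq> A \<and> K \<subseteq> A \<and> J \<inter> K = {} \<and> u - t \<le> card K}"
  define E where "E = (\<lambda>(J, K) (h :: 'i \<Rightarrow> 'p). \<forall>i\<in>K. h i \<in> G (restrict h J ` J))"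
  have D: "D \<subseteq> Pow A \<times> Pow A" by (auto simp: D_def)
  then have finD: "finite D" using fin(1) finite_subset by blast
  have "\<exists>x\<in>D. E x h" if h: "h \<in> A \<rightarrow>\<^sub>E P" and I: "I \<subseteq> h ` A" "Q I" "u \<le> card I" for h I
  proof -
    have "I \<subseteq> P" using I(1) h by auto
    then obtain F where F: "F \<subseteq> I" "I \<subseteq> G F" "card F \<le> t" using G(3) I(2) by blast
    from fin(1) I(1) F I(3) obtain J K where "J \<subseteq> A" "K \<subseteq> A" "J \<inter> K = {}" "u - t \<le> card K"
      and "\<And>i. i \<in> K \<Longrightarrow> h i \<in> G (h ` J)" by (rule fingerprint_preimages) (rule that)
    then have "(J, K) \<in> D" "E (J, K) h" by (simp_all add: D_def E_def)
    then show ?thesis by blast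
  qed
  then have "measure_pmf.prob (sample A P) {h. \<exists>I\<subseteq>h ` A. Q I \<and> u \<le> card I}
      \<le> measure_pmf.prob (sample A P) {h. \<exists>x\<in>D. E x h}"
    using set_pmf_sample[OF fin]
    by (intro measure_pmf.finite_measure_mono_AE) (auto simp: AE_measure_pmf_iff)
  also have "\<dots> \<le> real (card D) * \<rho> ^ (u - t)"
  proof (rule prob_bex_le_card_mult[OF finD])
    fix x assume "x \<in> D"
    then obtain J K where x: "x = (J, K)" and JK: "J \<subseteq> A" "K \<subseteq> A" "J \<inter> K = {}" "u - t \<le> card K"
      by (auto simp: D_def)
    have "measure_pmf.prob (sample A P) {h. E x h} \<le> \<rho> ^ card K"
      using prob_adaptive_event_le[OF fin JK(1-3), of "\<lambda>u. G (u ` J)"] G(1,2)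
      by (simp add: x E_def Int_absorb2)
    also have "\<dots> \<le> \<rho> ^ (u - t)" using JK(4) \<rho> by (rule power_decreasing)
    finally show "measure_pmf.prob (sample A P) {h. E x h} \<le> \<rho> ^ (u - t)" .
  qed
  also have "card D \<le> 4 ^ card A"
    using card_mono[OF _ D] fin(1)
    by (simp add: card_cartesian_product card_Pow flip: power_mult_distrib)
  finally show ?thesis using \<rho>(1) by (simp add: mult_right_mono)
qed

definition collides :: "'i set \<Rightarrow> ('i \<Rightarrow> 'p) \<Rightarrow> 'i \<Rightarrow> bool" where
  "collides A h i \<longleftrightarrow> (\<exists>j\<in>A - {i}. h i = h j)"

definition overcrowded :: "nat \<Rightarrow> ('l \<Rightarrow> 'p set) \<Rightarrow> 'l set \<Rightarrow> 'i set \<Rightarrow> ('i \<Rightarrow> 'p) \<Rightarrow> 'i \<Rightarrow> bool" where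
  "overcrowded k T L A h i \<longleftrightarrow> (\<exists>l\<in>L. h i \<in> T l \<and> k < card {j \<in> A. h j \<in> T l})"

lemma prob_collides_le:
  assumes fin: "finite A" "finite P" "P \<noteq> {}" and i: "i \<in> A"
  shows "measure_pmf.prob (sample A P) {h. collides A h i} \<le> real (card A) / real (card P)"
proof -
  have "measure_pmf.prob (sample A P) {h. h i = h j} \<le> 1 / real (card P)" if j: "j \<in> A - {i}" for j
  proof -
    have "real (card ({u j} \<inter> P)) \<le> 1 / real (card P) * real (card P)" for u :: "'a \<Rightarrow> 'b"
      using fin by (cases "u j \<in> P") (auto simp: card_gt_0_iff)
    moreover have "i \<noteq> j" using j by auto
    ultimately show ?thesis
      using prob_adaptive_event_le[OF fin, of "{j}" "{i}" "\<lambda>u. {u j}" "1 / real (card P)"] i j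
      by simp
  qed
  then have "measure_pmf.prob (sample A P) {h. collides A h i}
      \<le> real (card (A - {i})) * (1 / real (card P))"
    unfolding collides_def using fin(1) by (intro prob_bex_le_card_mult) auto
  also have "\<dots> \<le> real (card A) * (1 / real (card P))"
    using fin(1) by (intro mult_right_mono) (simp_all add: card_mono)
  finally show ?thesis by simp
qed

lemma overcrowdedE:
  assumes "overcrowded k T L A h i"
  obtains Z l where "Z \<subseteq> A - {i}" "card Z = k" "l \<in> L" "\<And>j. j \<in> insert i Z \<Longrightarrow> h j \<in> T l"
proof -
  obtain l where l: "l \<in> L" "h i \<in> T l" "k < card {j \<in> A. h j \<in> T l}"
    using assms by (auto simp: overcrowded_def)
  have "card {j \<in> A. h j \<in> T l} - card {i} \<le> card ({j \<in> A. h j \<in> T l} - {i})"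
    by (rule diff_card_le_card_Diff) simp
  then have "k \<le> card ({j \<in> A. h j \<in> T l} - {i})" using l(3) by simp
  then obtain Z where "Z \<subseteq> {j \<in> A. h j \<in> T l} - {i}" "card Z = k"
    by (meson obtain_subset_with_card_n)
  then show thesis using l(1,2) by (intro that[of Z l]) auto
qed

lemma card_subsets_le_power:
  assumes "finite A"
  shows "card {Z. Z \<subseteq> A \<and> card Z = k} \<le> card A ^ k"
  by (cases "k \<le> card A") (simp_all add: n_subsets[OF assms] binomial_le_pow binomial_eq_0)

lemma prob_overcrowded_le:
  fixes A :: "'i set" and P :: "'p set" and \<rho> :: real
  assumes fin: "finite A" "finite P" "P \<noteq> {}" "finite L" and i: "i \<in> A" and \<rho>: "0 \<le> \<rho>"
    and T: "\<And>l. l \<in> L \<Longrightarrow> real (card (T l \<inter> P)) \<le> \<rho> * real (card P)"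
  shows "measure_pmf.prob (sample A P) {h. overcrowded k T L A h i}
    \<le> real (card A) ^ k * real (card L) * \<rho> ^ Suc k"
proof -
  define \<Z> where "\<Z> = {Z. Z \<subseteq> A - {i} \<and> card Z = k}"
  define E where "E = (\<lambda>(Z, l) (h :: 'i \<Rightarrow> 'p). \<forall>j\<in>insert i Z. h j \<in> T l)"
  have fin\<Z>: "finite (\<Z> \<times> L)" using fin(1,4) by (simp add: \<Z>_def)
  have "\<exists>x\<in>\<Z> \<times> L. E x h" if "overcrowded k T L A h i" for h
  proof -
    from that obtain Z l where "Z \<subseteq> A - {i}" "card Z = k" "l \<in> L"
      and "\<And>j. j \<in> insert i Z \<Longrightarrow> h j \<in> T l" by (rule overcrowdedE) (rule that)
    then have "(Z, l) \<in> \<Z> \<times> L" "E (Z, l) h" by (simp_all add: \<Z>_def E_def)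
    then show ?thesis by blast
  qed
  then have "measure_pmf.prob (sample A P) {h. overcrowded k T L A h i}
      \<le> measure_pmf.prob (sample A P) {h. \<exists>x\<in>\<Z> \<times> L. E x h}"
    by (intro measure_pmf.finite_measure_mono) auto
  also have "\<dots> \<le> real (card (\<Z> \<times> L)) * \<rho> ^ Suc k"
  proof (rule prob_bex_le_card_mult[OF fin\<Z>])
    fix x assume "x \<in> \<Z> \<times> L"
    then obtain Z l where x: "x = (Z, l)" and Z: "Z \<subseteq> A" "i \<notin> Z" "card Z = k" and l: "l \<in> L"
      by (auto simp: \<Z>_def)
    have "card (insert i Z) = Suc k" using Z finite_subset[OF Z(1) fin(1)] by simp
    then show "measure_pmf.prob (sample A P) {h. E x h} \<le> \<rho> ^ Suc k"
      using prob_adaptive_event_le[OF fin(1-3), of "{}" "insert i Z" "\<lambda>_. T l" \<rho>] Z(1) i T[OF l]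
      by (simp add: x E_def)
  qed
  also have "\<dots> \<le> real (card A) ^ k * real (card L) * \<rho> ^ Suc k"
  proof -
    have "card \<Z> \<le> card (A - {i}) ^ k"
      unfolding \<Z>_def using fin(1) by (intro card_subsets_le_power) simp
    also have "\<dots> \<le> card A ^ k" using fin(1) by (intro power_mono card_mono) auto
    finally have "real (card \<Z>) \<le> real (card A) ^ k" by (simp flip: of_nat_power)
    then show ?thesis
      using \<rho> by (simp add: card_cartesian_product mult_right_mono)
  qed
  finally show ?thesis .
qed

lemma ex_less_of_expectation_less:
  assumes "finite (set_pmf p)" "measure_pmf.expectation p f < (c :: real)"
  shows "\<exists>x\<in>set_pmf p. f x < c"
proof (rule ccontr)
  assume "\<not> ?thesis"
  then have "AE x in measure_pmf p. c \<le> f x" by (simp add: AE_measure_pmf_iff not_less)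
  then have "c \<le> measure_pmf.expectation p f"
    using assms(1) by (intro measure_pmf.integral_ge_const integrable_measure_pmf_finite)
  then show False using assms(2) by simp
qed

lemma ex_few_marked:
  fixes \<eta> \<kappa> \<beta> :: real
  assumes fin: "finite (set_pmf p)" "finite A" and A: "A \<noteq> {}" and \<eta>: "0 \<le> \<eta>" "\<kappa> + \<eta> * \<beta> < \<eta>"
    and marked: "\<And>i. i \<in> A \<Longrightarrow> measure_pmf.prob p {h. marked h i} \<le> \<kappa>"
    and bad: "measure_pmf.prob p {h. bad h} \<le> \<beta>"
  shows "\<exists>h\<in>set_pmf p. \<not> bad h \<and> real (card {i \<in> A. marked h i}) < \<eta> * real (card A)"
proof -
  define cost :: "'a \<Rightarrow> real" where "cost h =
    (\<Sum>i\<in>A. indicator {h. marked h i} h) + \<eta> * real (card A) * indicator {h. bad h} h" for h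
  have card: "(\<Sum>i\<in>A. indicator {h. marked h i} h) = real (card {i \<in> A. marked h i})" for h
    using fin(2) by (simp add: indicator_def sum.If_cases Int_def)
  have "measure_pmf.expectation p cost = (\<Sum>i\<in>A. measure_pmf.prob p {h. marked h i})
      + \<eta> * real (card A) * measure_pmf.prob p {h. bad h}"
    unfolding cost_def using fin(1) by (simp add: integrable_measure_pmf_finite)
  also have "\<dots> \<le> real (card A) * \<kappa> + \<eta> * real (card A) * \<beta>"
    using \<eta>(1) marked bad by (intro add_mono sum_bounded_above mult_left_mono) auto
  also have "\<dots> = real (card A) * (\<kappa> + \<eta> * \<beta>)" by (simp add: algebra_simps)
  also have "\<dots> < real (card A) * \<eta>"
    using \<eta>(2) fin(2) A by (intro mult_strict_left_mono) (simp_all add: card_gt_0_iff)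
  finally obtain h where h: "h \<in> set_pmf p" "cost h < real (card A) * \<eta>"
    using ex_less_of_expectation_less[OF fin(1)] by blast
  then have "\<not> bad h" by (auto simp: cost_def card mult.commute)
  then have "cost h = real (card {i \<in> A. marked h i})" by (simp add: cost_def card)
  then show ?thesis using h \<open>\<not> bad h\<close> by (auto simp: mult.commute)
qed

lemma card_delete_marked_ge:
  assumes "finite A" "\<And>i. collides A h i \<Longrightarrow> marked i"
  shows "card A - card {i \<in> A. marked i} \<le> card (h ` {i \<in> A. \<not> marked i})"
proof -
  have "inj_on h {i \<in> A. \<not> marked i}"
    using assms(2) by (intro inj_onI) (auto simp: collides_def)
  moreover have "{i \<in> A. \<not> marked i} = A - {i \<in> A. marked i}" by auto
  ultimately show ?thesis using assms(1) by (simp add: card_image card_Diff_subset)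
qed

lemma card_Int_delete_marked_le:
  assumes "finite A" "l \<in> L" "\<And>i. overcrowded k T L A h i \<Longrightarrow> marked i"
  shows "card (T l \<inter> h ` {i \<in> A. \<not> marked i}) \<le> k"
proof (cases "T l \<inter> h ` {i \<in> A. \<not> marked i} = {}")
  case False
  then obtain i where i: "h i \<in> T l" "\<not> marked i" by blast
  have "T l \<inter> h ` {i \<in> A. \<not> marked i} \<subseteq> h ` {i \<in> A. h i \<in> T l}" by blast
  then have "card (T l \<inter> h ` {i \<in> A. \<not> marked i}) \<le> card {i \<in> A. h i \<in> T l}"
    using assms(1) by (intro surj_card_le) auto
  also have "\<dots> \<le> k"
    using i assms(2,3) unfolding overcrowded_def by (meson not_le)
  finally show ?thesis .
qed simp

lemma prob_collides_or_overcrowded_le: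
  fixes \<sigma> :: real
  assumes fin: "finite A" "finite P" "P \<noteq> {}" "finite L" and "i \<in> A" and "0 \<le> \<sigma>"
    and "\<And>l. l \<in> L \<Longrightarrow> real (card (T l \<inter> P)) \<le> \<sigma> * real (card P)"
  shows "measure_pmf.prob (sample A P) {h. collides A h i \<or> overcrowded k T L A h i}
    \<le> real (card A) / real (card P) + real (card A) ^ k * real (card L) * \<sigma> ^ Suc k"
proof -
  have "measure_pmf.prob (sample A P) {h. collides A h i \<or> overcrowded k T L A h i}
      \<le> measure_pmf.prob (sample A P) {h. collides A h i}
        + measure_pmf.prob (sample A P) {h. overcrowded k T L A h i}"
    unfolding Collect_disj_eq by (rule measure_Un_le) simp_all
  then show ?thesis
    using prob_collides_le[OF fin(1-3) assms(5)]
      prob_overcrowded_le[where T = T and k = k, OF fin assms(5-)] by linarith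
qed

theorem sparse_subset_exists:
  fixes \<rho> \<sigma> \<eta> :: real and s k t u :: nat
  assumes fin: "finite P" "P \<noteq> {}" "finite L"
    and T: "0 \<le> \<sigma>" "\<And>l. l \<in> L \<Longrightarrow> real (card (T l \<inter> P)) \<le> \<sigma> * real (card P)"
    and \<rho>: "0 \<le> \<rho>" "\<rho> \<le> 1" and containers: "container_map Q t (\<rho> * real (card P)) P C"
    and s: "0 < s" and \<eta>: "0 \<le> \<eta>"
      "real s / real (card P) + real s ^ k * real (card L) * \<sigma> ^ Suc k
        + \<eta> * (4 ^ s * \<rho> ^ (u - t)) < \<eta>"
  shows "\<exists>S\<subseteq>P. (1 - \<eta>) * real s \<le> real (card S) \<and> card S \<le> s \<and>
    (\<forall>l\<in>L. card (T l \<inter> S) \<le> k) \<and> (\<forall>I\<subseteq>S. Q I \<longrightarrow> card I < u)"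
proof -
  let ?A = "{..<s}"
  let ?p = "sample ?A P"
  define marked where "marked h i \<longleftrightarrow> collides ?A h i \<or> overcrowded k T L ?A h i" for h i
  have A: "finite ?A" "?A \<noteq> {}" "card ?A = s" using s by (simp_all add: lessThan_empty_iff)
  have set_p: "set_pmf ?p = ?A \<rightarrow>\<^sub>E P" using set_pmf_sample[OF A(1) fin(1,2)] .
  then have fin_p: "finite (set_pmf ?p)" using fin(1) by (simp add: finite_PiE)
  have marked: "measure_pmf.prob ?p {h. marked h i}
      \<le> real s / real (card P) + real s ^ k * real (card L) * \<sigma> ^ Suc k" if "i \<in> ?A" for i
    using prob_collides_or_overcrowded_le[where T = T and k = k, OF A(1) fin that T]
    unfolding A(3) marked_def .
  have "measure_pmf.prob ?p {h. \<exists>I\<subseteq>h ` ?A. Q I \<and> u \<le> card I} \<le> 4 ^ s * \<rho> ^ (u - t)"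
    using prob_large_subset_le[OF A(1) fin(1,2) \<rho> containers] unfolding A(3) .
  from ex_few_marked[where marked = marked, OF fin_p A(1,2) \<eta> marked this]
  obtain h where h: "h \<in> ?A \<rightarrow>\<^sub>E P" "\<And>I. I \<subseteq> h ` ?A \<Longrightarrow> Q I \<Longrightarrow> card I < u"
    "real (card {i \<in> ?A. marked h i}) < \<eta> * real s"
    unfolding set_p A(3) by (auto simp: not_le)
  define S where "S = h ` {i \<in> ?A. \<not> marked h i}"
  have sub: "S \<subseteq> h ` ?A" by (auto simp: S_def)
  have "S \<subseteq> P" using sub h(1) by auto
  moreover have "(1 - \<eta>) * real s \<le> real (card S)"
    using card_delete_marked_ge[OF A(1), of h "marked h"] h(3)
    unfolding S_def A(3) by (simp add: marked_def algebra_simps)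
  moreover have "card S \<le> s" using surj_card_le[OF A(1) sub] by simp
  moreover have "card (T l \<inter> S) \<le> k" if "l \<in> L" for l
    unfolding S_def using that by (intro card_Int_delete_marked_le A(1)) (auto simp: marked_def)
  moreover have "card I < u" if "I \<subseteq> S" "Q I" for I
    using h(2)[OF subset_trans[OF that(1) sub] that(2)] .
  ultimately show ?thesis by blast
qed

section \<open>A sparse set in the integer grid\<close>

text \<open>The pair \<open>(a, b)\<close> stands for the line \<open>y = a x + b\<close>.\<close>
definition grid_height :: "nat \<Rightarrow> nat \<times> nat \<Rightarrow> nat" where
  "grid_height j l = fst l * j + snd l"

interpretation grid: line_system grid_height
proof
  fix i j l l'
  assume "i \<noteq> j" "grid_height i l = grid_height i l'" "grid_height j l = grid_height j l'"
  moreover obtain a b a' b' where l: "l = (a, b)" "l' = (a', b')" by fastforce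
  ultimately have "int a * i + b = int a' * i + b'" "int a * j + b = int a' * j + b'"
    unfolding grid_height_def by (simp_all flip: of_nat_mult of_nat_add)
  then have "(int a - a') * (int i - j) = 0" by (simp add: algebra_simps)
  then have "a = a'" using \<open>i \<noteq> j\<close> by simp
  then show "l = l'" using \<open>grid_height i l = grid_height i l'\<close> by (simp add: l grid_height_def)
qed

lemma card_pencil_slopes_le: "card (grid.pencil ({..<q} \<times> B) j y) \<le> q"
proof -
  have "inj_on fst (grid.pencil ({..<q} \<times> B) j y)"
    by (auto simp: inj_on_def grid.pencil_def grid_height_def)
  moreover have "fst ` grid.pencil ({..<q} \<times> B) j y \<subseteq> {..<q}" by (auto simp: grid.pencil_def)
  ultimately show ?thesis using card_inj_on_le[of fst _ "{..<q}"] by simp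
qed

definition width :: "nat \<Rightarrow> nat" where
  "width k = 4 * 4096 * k"

definition rounds :: "nat \<Rightarrow> nat" where
  "rounds k = 8 * 4096 * width k * 2 ^ width k * (4 * k) ^ (k - 1)"

locale sampling_parameters =
  fixes k Q s :: nat
  assumes k_pos: "0 < k" and Q_large: "1224 * k * rounds k \<le> Q" and s_large: "Q ^ (k * k) \<le> s"
begin

text \<open>
  With these choices, \<open>intercepts ^ k = 100 ^ k * slopes * s ^ k\<close> makes lines with more than \<open>k\<close>
  sample points rare, while the number of picked points is about \<open>rounds k * k * heights / Q ^ k\<close>,
  that is, of order \<open>rounds k * k * s / Q\<close>.
\<close>
definition slopes :: nat where "slopes = (Q ^ k) ^ (k - 1)"
definition intercepts :: nat where "intercepts = 100 * Q ^ (k - 1) * s"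
definition heights :: nat where "heights = intercepts + width k * slopes"
definition picks :: nat where "picks = heights div Q ^ k + 1"

abbreviation grid_points :: "(nat \<times> nat) set" where
  "grid_points \<equiv> {..<width k} \<times> {..<heights}"

abbreviation grid_lines :: "(nat \<times> nat) set" where
  "grid_lines \<equiv> {..<slopes} \<times> {..<intercepts}"

abbreviation grid_line_free :: "(nat \<times> nat) set \<Rightarrow> bool" where
  "grid_line_free \<equiv> grid.line_free {..<width k} grid_lines k"

lemma width_le_Q: "16384 * width k \<le> Q"
proof -
  have "16384 * width k * 1 \<le> 16384 * width k * (2448 * k * (2 ^ width k * (4 * k) ^ (k - 1)))"
    using k_pos by (intro mult_le_mono2) (simp add: Suc_le_eq)
  also have "\<dots> = 1224 * k * rounds k" by (simp add: rounds_def)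
  finally show ?thesis using Q_large by simp
qed

lemma Q_pos: "0 < Q"
  using width_le_Q k_pos by (simp add: width_def)

lemma Q_le_s: "Q \<le> s"
proof -
  have "Q ^ 1 \<le> Q ^ (k * k)" using Q_pos k_pos by (intro power_increasing) simp_all
  then show ?thesis using s_large by simp
qed

lemma Q_mult_power: "Q * Q ^ (k - 1) = Q ^ k"
  using k_pos by (simp flip: power_Suc)

lemma width_slopes_le: "16384 * (width k * slopes) \<le> s"
proof -
  have "16384 * (width k * slopes) \<le> Q * slopes"
    using mult_le_mono1[OF width_le_Q, of slopes] by simp
  also have "\<dots> \<le> Q ^ k * slopes" using Q_pos k_pos by (intro mult_le_mono1 self_le_power) simp_all
  also have "\<dots> = Q ^ (k * k)"
    unfolding slopes_def power_Suc[symmetric] using k_pos by (simp add: power_mult)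
  finally show ?thesis using s_large by simp
qed

lemma s_le_intercepts: "100 * s \<le> intercepts"
  using Q_pos by (simp add: intercepts_def)

sublocale nearly_regular_line_family
  grid_height "{..<width k}" "{..<heights}" grid_lines slopes "1 / 4096"
proof unfold_locales
  show "grid_height j l \<in> {..<heights}" if "j \<in> {..<width k}" "l \<in> grid_lines" for j l
  proof -
    have "fst l * j \<le> slopes * width k" using that by (intro mult_le_mono) auto
    then show ?thesis using that(2) by (auto simp: grid_height_def heights_def mult.commute)
  qed
  have "real (16384 * (width k * slopes)) \<le> real intercepts"
    using width_slopes_le s_le_intercepts by (simp only: of_nat_le_iff)
  then have "(1 - 1 / 4096 / 4) * real heights * real slopes \<le> real intercepts * real slopes"
    by (intro mult_right_mono) (simp_all add: heights_def)
  then show "(1 - 1 / 4096 / 4) * real (card {..<heights} * slopes) \<le> real (card grid_lines)"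
    by (simp add: card_cartesian_product mult.commute)
qed (simp_all add: card_pencil_slopes_le)

lemma grid_containers:
  "\<exists>A. container_map grid_line_free (rounds k * ((k - 1) * picks))
    (1 / 4096 * real (card grid_points)) grid_points A"
proof -
  have "real (rounds k) * shrinkage k = real (width k)"
    using k_pos by (simp add: shrinkage_def rounds_def)
  moreover have "heights \<le> picks * Q ^ k"
    unfolding picks_def using Q_pos dividend_less_div_times[of "Q ^ k" heights] by simp
  ultimately show ?thesis
    using line_free_containers[of k "Q ^ k" picks "rounds k"] k_pos Q_pos
    by (simp add: slopes_def width_def card_cartesian_product mult.assoc)
qed

lemma fingerprint_size_le: "12 * (rounds k * ((k - 1) * picks)) \<le> s"
proof -
  have "s * 1 \<le> s * Q ^ (k - 1)" using Q_pos by (intro mult_le_mono2) simp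
  then have "width k * slopes \<le> s * Q ^ (k - 1)" using width_slopes_le by linarith
  then have "heights \<le> 101 * s * Q ^ (k - 1)" by (simp add: heights_def intercepts_def mult.commute)
  moreover have "heights div Q ^ k * Q * Q ^ (k - 1) \<le> heights"
    by (metis Q_mult_power div_times_less_eq_dividend mult.assoc)
  ultimately have "heights div Q ^ k * Q \<le> 101 * s"
    using Q_pos by (metis mult_le_cancel2 order_trans zero_less_power)
  then have picks: "picks * Q \<le> 102 * s" using Q_le_s by (simp add: picks_def)
  have "12 * (rounds k * ((k - 1) * picks)) * Q = 12 * rounds k * (k - 1) * (picks * Q)" by simp
  also have "\<dots> \<le> 12 * rounds k * k * (102 * s)" by (intro mult_le_mono picks) simp_all
  also have "\<dots> = 1224 * k * rounds k * s" by simp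
  also have "\<dots> \<le> s * Q" using mult_le_mono1[OF Q_large, of s] by (simp add: mult.commute)
  finally show ?thesis using Q_pos by simp
qed

lemma crowding_le:
  "real s / real (card grid_points)
    + real s ^ k * real (card grid_lines) * (1 / real heights) ^ Suc k \<le> 1 / 50"
proof -
  have s_pos: "0 < s" using Q_pos Q_le_s by simp
  then have intercepts_pos: "0 < intercepts" using s_le_intercepts by simp
  have "intercepts \<le> heights" by (simp add: heights_def)
  also have "\<dots> \<le> width k * heights" using k_pos by (simp add: width_def)
  finally have "intercepts \<le> width k * heights" .
  then have "100 * s \<le> card grid_points" using s_le_intercepts by (simp add: card_cartesian_product)
  then have "real (100 * s) \<le> real (card grid_points)" by (simp only: of_nat_le_iff)
  then have collisions: "real s / real (card grid_points) \<le> 1 / 100"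
    using s_pos by (simp add: divide_le_eq del: card_cartesian_product)
  have "100 ^ k * (s ^ k * slopes) = intercepts ^ k"
    by (simp add: intercepts_def slopes_def power_mult_distrib mult_ac flip: power_mult)
  then have "100 ^ k * (real s ^ k * real slopes) = real intercepts ^ k"
    by (metis of_nat_mult of_nat_numeral of_nat_power)
  then have s_power_slopes: "real s ^ k * real slopes = real intercepts ^ k / 100 ^ k"
    by (simp add: field_simps)
  have "real s ^ k * real (card grid_lines) * (1 / real heights) ^ Suc k
      = real s ^ k * real slopes * (real intercepts / real heights ^ Suc k)"
    by (simp add: card_cartesian_product power_divide)
  also have "\<dots> \<le> real s ^ k * real slopes * (real intercepts / real intercepts ^ Suc k)"
    using intercepts_pos
    by (intro mult_left_mono frac_le power_mono zero_less_power) (simp_all add: heights_def)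
  also have "\<dots> = 1 / 100 ^ k" using intercepts_pos by (simp add: s_power_slopes)
  also have "\<dots> \<le> 1 / 100 ^ 1" using k_pos by (intro divide_left_mono power_increasing) simp_all
  also have "\<dots> = 1 / 100" by simp
  finally show ?thesis using collisions by linarith
qed

lemma two_le_s: "2 \<le> s"
  using width_le_Q Q_le_s k_pos by (simp add: width_def)

lemma union_bound_le:
  defines "t \<equiv> rounds k * ((k - 1) * picks)"
  shows "4 ^ s * (1 / 4096) ^ (Suc (s div 3) - t) \<le> (1 / 4 :: real)"
proof -
  define w where "w = Suc (s div 3) - t"
  have "s \<le> 4 * w" using fingerprint_size_le unfolding t_def w_def by linarith
  then have "(1 / 8 :: real) ^ (4 * w) \<le> (1 / 8) ^ s" by (rule power_decreasing) simp_all
  moreover have "(1 / 4096 :: real) ^ w = (1 / 8) ^ (4 * w)"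
    unfolding power_mult by (simp add: power_divide)
  ultimately have "4 ^ s * (1 / 4096) ^ w \<le> 4 ^ s * (1 / 8 :: real) ^ s"
    by (intro mult_left_mono) simp_all
  also have "\<dots> = (1 / 2) ^ s" unfolding power_mult_distrib[symmetric] by simp
  also have "\<dots> \<le> (1 / 2) ^ 2" using two_le_s by (rule power_decreasing) simp_all
  finally show ?thesis by (simp add: w_def power2_eq_square)
qed

lemma sparse_grid_subset_exists:
  "\<exists>S\<subseteq>grid_points. 9 / 10 * real s \<le> real (card S) \<and> card S \<le> s \<and>
    (\<forall>l\<in>grid_lines. card (grid.trace {..<width k} l \<inter> S) \<le> k) \<and>
    (\<forall>I\<subseteq>S. grid_line_free I \<longrightarrow> 3 * card I \<le> s)"
proof -
  define t u where "t = rounds k * ((k - 1) * picks)" and "u = Suc (s div 3)"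
  obtain A where
    A: "container_map grid_line_free t (1 / 4096 * real (card grid_points)) grid_points A"
    unfolding t_def using grid_containers by blast
  have margin: "real s / real (card grid_points) +
      real s ^ k * real (card grid_lines) * (1 / real heights) ^ Suc k +
      1 / 10 * (4 ^ s * (1 / 4096) ^ (u - t)) < 1 / 10"
    using crowding_le union_bound_le unfolding t_def u_def by linarith
  have heights: "0 < heights"
    using two_le_s s_le_intercepts by (simp add: heights_def)
  have "\<exists>S\<subseteq>grid_points. (1 - 1 / 10) * real s \<le> real (card S) \<and> card S \<le> s \<and>
      (\<forall>l\<in>grid_lines. card (grid.trace {..<width k} l \<inter> S) \<le> k) \<and>
      (\<forall>I\<subseteq>S. grid_line_free I \<longrightarrow> card I < u)"
  proof (rule sparse_subset_exists[OF _ _ _ _ _ _ _ A _ _ margin])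
    show "grid_points \<noteq> {}" using heights k_pos by (auto simp: width_def lessThan_empty_iff)
    show "real (card (grid.trace {..<width k} l \<inter> grid_points))
        \<le> 1 / real heights * real (card grid_points)" for l
    proof -
      have "card (grid.trace {..<width k} l \<inter> grid_points) \<le> card (grid.trace {..<width k} l)"
        by (intro card_mono finite_trace) simp
      then show ?thesis using heights by (simp add: grid.card_trace card_cartesian_product)
    qed
  qed (use two_le_s in simp_all)
  moreover have "card I < u \<longleftrightarrow> 3 * card I \<le> s" for I :: "(nat \<times> nat) set"
    unfolding u_def by linarith
  ultimately show ?thesis by simp
qed

end

section \<open>Large nets\<close>

definition plane_line :: "nat \<times> nat \<Rightarrow> (real \<times> real) set" where
  "plane_line l = {(x, y). real (fst l) * x + (- 1) * y = - real (snd l)}"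

lemma is_line_plane_line: "is_line (plane_line l)"
  unfolding is_line_def plane_line_def
  by (intro exI[of _ "real (fst l)"] exI[of _ "- 1"] exI[of _ "- real (snd l)"]) simp

lemma real_in_plane_line_iff: "(real j, real y) \<in> plane_line l \<longleftrightarrow> y = grid_height j l"
proof -
  have "(real j, real y) \<in> plane_line l \<longleftrightarrow> real y = real (grid_height j l)"
    by (auto simp: plane_line_def grid_height_def)
  then show ?thesis by (simp only: of_nat_eq_iff)
qed

lemma card_map_prod_real: "card (map_prod real real ` A) = card A"
  by (intro card_image inj_onI) auto

lemma net_complement_line_free:
  assumes S: "finite S" "S \<subseteq> X \<times> UNIV" "\<And>l. l \<in> L \<Longrightarrow> card (grid.trace X l \<inter> S) \<le> k"
    and net: "eps * real (card S) \<le> real k" "eps_net_lines eps (map_prod real real ` S) T"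
  shows "grid.line_free X L k {p \<in> S. map_prod real real p \<notin> T}"
  unfolding grid.line_free_def
proof (intro ballI, rule ccontr)
  fix l
  let ?\<phi> = "map_prod real real" and ?I = "{p \<in> S. map_prod real real p \<notin> T}"
  assume l: "l \<in> L" and "\<not> card (grid.trace X l \<inter> ?I) < k"
  then have I: "k \<le> card (grid.trace X l \<inter> ?I)" by simp
  have same_trace: "grid.trace X l \<inter> ?I = grid.trace X l \<inter> S"
  proof (rule card_seteq)
    show "card (grid.trace X l \<inter> S) \<le> card (grid.trace X l \<inter> ?I)"
      using S(3)[OF l] I by (rule order_trans)
  qed (use S(1) in auto)
  have on_line: "p \<in> grid.trace X l \<longleftrightarrow> ?\<phi> p \<in> plane_line l" if "p \<in> S" for p
  proof -
    obtain j y where p: "p = (j, y)" by fastforce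
    then have "j \<in> X" using that S(2) by blast
    then show ?thesis by (auto simp: p grid.trace_def real_in_plane_line_iff)
  qed
  then have "?\<phi> ` (grid.trace X l \<inter> S) \<subseteq> plane_line l \<inter> ?\<phi> ` S"
    unfolding image_subset_iff by auto
  then have "card (?\<phi> ` (grid.trace X l \<inter> S)) \<le> card (plane_line l \<inter> ?\<phi> ` S)"
    using S(1) by (intro card_mono) simp_all
  then have "eps * real (card (?\<phi> ` S)) \<le> real (card (plane_line l \<inter> ?\<phi> ` S))"
    using net(1) I unfolding same_trace card_map_prod_real by linarith
  then have "T \<inter> plane_line l \<noteq> {}" and "T \<subseteq> ?\<phi> ` S"
    using net(2) is_line_plane_line[of l] by (simp_all add: eps_net_lines_def)
  then obtain x where x: "x \<in> T" "x \<in> plane_line l" "x \<in> ?\<phi> ` S" by blast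
  from x(3) obtain p where p: "x = ?\<phi> p" "p \<in> S" by (rule imageE)
  then have "p \<in> grid.trace X l \<inter> ?I" using on_line same_trace x(2) by simp
  then show False using p(1) x(1) by simp
qed

lemma planar_set_with_large_nets:
  assumes "sampling_parameters k Q s"
  shows "\<exists>S. finite S \<and> S \<noteq> {} \<and>
    (\<forall>eps T. 0 \<le> eps \<and> eps * real s \<le> real k \<and> eps_net_lines eps S T \<longrightarrow>
      17 / 30 * real s \<le> real (card T))"
proof -
  interpret sampling_parameters k Q s by (rule assms)
  let ?\<phi> = "map_prod real real"
  obtain S where S: "S \<subseteq> grid_points" "9 / 10 * real s \<le> real (card S)" "card S \<le> s"
    and few: "\<And>l. l \<in> grid_lines \<Longrightarrow> card (grid.trace {..<width k} l \<inter> S) \<le> k"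
    and small: "\<And>I. I \<subseteq> S \<Longrightarrow> grid_line_free I \<Longrightarrow> 3 * card I \<le> s"
    using sparse_grid_subset_exists by blast
  have finS: "finite S" using S(1) by (rule finite_subset) simp
  have "17 / 30 * real s \<le> real (card T)"
    if eps: "0 \<le> eps" "eps * real s \<le> real k" and net: "eps_net_lines eps (?\<phi> ` S) T" for eps T
  proof -
    let ?I = "{p \<in> S. ?\<phi> p \<notin> T}"
    have "eps * real (card S) \<le> eps * real s" using eps(1) S(3) by (intro mult_left_mono) simp_all
    then have "grid_line_free ?I"
      using S(1) few eps(2) net by (intro net_complement_line_free finS) auto
    then have I: "3 * card ?I \<le> s" by (intro small) auto
    have "T \<subseteq> ?\<phi> ` S" using net by (simp add: eps_net_lines_def)
    then have finT: "finite T" using finS finite_subset by blast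
    have "card S = card (?\<phi> ` S)" by (simp only: card_map_prod_real)
    also have "\<dots> \<le> card (?\<phi> ` ?I \<union> T)" using finS finT by (intro card_mono) auto
    also have "\<dots> \<le> card (?\<phi> ` ?I) + card T" by (rule card_Un_le)
    also have "\<dots> \<le> card ?I + card T" using finS by (simp add: card_image_le)
    finally show ?thesis using I S(2) by linarith
  qed
  moreover have "S \<noteq> {}" using S(2) Q_pos Q_le_s by auto
  ultimately show ?thesis using finS by (intro exI[of _ "?\<phi> ` S"]) auto
qed

definition net_gain :: "real \<Rightarrow> real" where
  "net_gain X = X powr (1 / 3) / log 2 X"

lemma power_two_cubed_le:
  fixes X :: real and k :: nat
  assumes X: "16 \<le> X" "2 * net_gain X \<le> X" and k: "0 < k" "real k \<le> 2 * net_gain X"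
  shows "real k ^ (2 * k ^ 3) \<le> 2 powr X"
proof -
  have log_ge: "4 \<le> log 2 X" using X(1) by (simp add: le_log_iff)
  have "real k ^ (2 * k ^ 3) = (2 powr log 2 (real k)) ^ (2 * k ^ 3)" using k(1) by simp
  also have "\<dots> = 2 powr (2 * (real k ^ 3 * log 2 (real k)))"
    by (simp add: powr_powr mult_ac flip: powr_realpow)
  also have "\<dots> \<le> 2 powr X"
  proof (rule powr_mono)
    have "real k ^ 3 * log 2 (real k) \<le> (2 * net_gain X) ^ 3 * log 2 X"
      using k X by (intro mult_mono power_mono) auto
    also have "(2 * net_gain X) ^ 3 = 8 * X / (log 2 X) ^ 3"
    proof -
      have "(X powr (1/3)) ^ 3 = X" using X(1) by (simp flip: powr_numeral add: powr_powr)
      then show ?thesis by (simp add: net_gain_def power_mult_distrib power_divide)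
    qed
    also have "8 * X / (log 2 X) ^ 3 * log 2 X = 8 * X / (log 2 X)\<^sup>2"
      using log_ge by (simp add: power3_eq_cube power2_eq_square)
    also have "\<dots> \<le> 8 * X / 4\<^sup>2"
      using X(1) log_ge by (intro divide_left_mono power_mono) auto
    finally show "2 * (real k ^ 3 * log 2 (real k)) \<le> X" by simp
  qed simp
  finally show ?thesis .
qed

lemma sampling_parameters_at_scale:
  fixes X :: real and k s :: nat
  assumes "16 \<le> X" "2 * net_gain X \<le> X" and k: "0 < k" "real k \<le> 2 * net_gain X"
    and rounds: "1224 * k * rounds k \<le> k ^ (2 * k)" and s: "2 powr X \<le> real s"
  shows "sampling_parameters k (k ^ (2 * k)) s"
proof
  have "real ((k ^ (2 * k)) ^ (k * k)) = real k ^ (2 * k ^ 3)"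
    by (simp add: power3_eq_cube mult_ac flip: power_mult)
  also have "\<dots> \<le> 2 powr X"
    using assms(1-4) by (rule power_two_cubed_le)
  finally show "(k ^ (2 * k)) ^ (k * k) \<le> s" using s by linarith
qed (use k rounds in simp_all)

lemma large_nets_at_scale:
  fixes eps :: real
  defines "X \<equiv> log 2 (1 / eps)"
  defines "Y \<equiv> net_gain X"
  defines "k \<equiv> nat \<lceil>Y\<rceil>"
  assumes eps: "0 < eps" "eps < 1" and X: "16 \<le> X" "2 * Y \<le> X" and Y: "9 \<le> Y"
    and rounds: "1224 * k * rounds k \<le> k ^ (2 * k)"
  shows "\<exists>S. finite S \<and> S \<noteq> {} \<and> (\<forall>T. eps_net_lines eps S T \<longrightarrow> 1 / (2 * eps) * Y \<le> real (card T))"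
proof -
  define s where "s = nat \<lfloor>real k / eps\<rfloor>"
  have k: "Y \<le> real k" "real k \<le> 2 * Y" "9 \<le> real k" using Y unfolding k_def by linarith+
  have s: "real s \<le> real k / eps" "real k / eps - 1 < real s"
    using eps(1) k(3) unfolding s_def by (simp_all add: le_nat_floor)
  have "2 powr X = 1 / eps" unfolding X_def using eps(1) by simp
  also have "\<dots> \<le> real s"
  proof -
    have "1 \<le> 1 / eps" using eps by simp
    moreover have "2 * (1 / eps) \<le> real k * (1 / eps)"
      using k(3) eps(1) by (intro mult_right_mono) auto
    ultimately show ?thesis using s(2) by simp
  qed
  finally have "2 powr X \<le> real s" .
  then have "sampling_parameters k (k ^ (2 * k)) s"
    using X k(2,3) rounds unfolding Y_def by (intro sampling_parameters_at_scale) simp_all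
  from planar_set_with_large_nets[OF this] obtain S where S: "finite S" "S \<noteq> {}"
    "\<And>T. eps * real s \<le> real k \<Longrightarrow> eps_net_lines eps S T \<Longrightarrow> 17 / 30 * real s \<le> real (card T)"
    using eps(1) by (metis less_imp_le)
  have "1 / (2 * eps) * Y \<le> real (card T)" if "eps_net_lines eps S T" for T
  proof -
    have T: "17 / 30 * real s \<le> real (card T)"
      using s(1) eps(1) that by (intro S(3)) (auto simp: field_simps)
    define z w where "z = Y / eps" and "w = real k / eps"
    have "z \<le> w" unfolding z_def w_def using k(1) eps(1) by (intro divide_right_mono) auto
    moreover have "9 / 1 \<le> z" unfolding z_def using Y eps by (intro frac_le) auto
    ultimately have "z / 2 \<le> real (card T)" using T s(2)[folded w_def] by linarith
    then show ?thesis by (simp add: z_def)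
  qed
  then show ?thesis using S(1,2) by blast
qed

lemma eventually_rounds_le_power: "eventually (\<lambda>k. 1224 * k * rounds k \<le> k ^ (2 * k)) sequentially"
proof -
  have "eventually (\<lambda>k::nat. 1224 * real k *
      (8 * 4096 * (4 * 4096 * real k) * 2 ^ (4 * 4096 * k) * (4 * real k) ^ (k - 1))
        \<le> real k ^ (2 * k)) sequentially"
    by real_asymp
  then show ?thesis
  proof (rule eventually_mono)
    fix k
    assume "1224 * real k *
      (8 * 4096 * (4 * 4096 * real k) * 2 ^ (4 * 4096 * k) * (4 * real k) ^ (k - 1)) \<le> real k ^ (2 * k)"
    then have "real (1224 * k * rounds k) \<le> real (k ^ (2 * k))"
      by (simp add: rounds_def width_def)
    then show "1224 * k * rounds k \<le> k ^ (2 * k)" by (simp only: of_nat_le_iff)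
  qed
qed

theorem theorem2p2:
  shows "\<exists>e0 > 0. \<forall>eps. 0 < eps \<and> eps < e0 \<longrightarrow>
    (\<exists>S :: (real \<times> real) set. finite S \<and> S \<noteq> {} \<and>
      (\<forall>T. eps_net_lines eps S T \<longrightarrow>
         real (card T) \<ge> (1 / (2 * eps)) * (log 2 (1 / eps)) powr (1/3) / log 2 (log 2 (1 / eps))))"
proof -
  let ?X = "\<lambda>eps::real. log 2 (1 / eps)"
  let ?Y = "\<lambda>eps. net_gain (?X eps)"
  let ?k = "\<lambda>eps. nat \<lceil>?Y eps\<rceil>"
  have "filterlim ?k sequentially (at_right 0)" unfolding net_gain_def by real_asymp
  then have "eventually (\<lambda>eps. 1224 * ?k eps * rounds (?k eps) \<le> ?k eps ^ (2 * ?k eps))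
      (at_right 0)"
    by (rule eventually_compose_filterlim[OF eventually_rounds_le_power])
  moreover have "eventually (\<lambda>eps. 16 \<le> ?X eps) (at_right 0)"
    "eventually (\<lambda>eps. 2 * ?Y eps \<le> ?X eps) (at_right 0)"
    "eventually (\<lambda>eps. 9 \<le> ?Y eps) (at_right 0)"
    "eventually (\<lambda>eps::real. eps < 1) (at_right 0)"
    unfolding net_gain_def by real_asymp+
  ultimately have "eventually (\<lambda>eps. \<exists>S. finite S \<and> S \<noteq> {} \<and>
      (\<forall>T. eps_net_lines eps S T \<longrightarrow> 1 / (2 * eps) * ?Y eps \<le> real (card T))) (at_right 0)"
    using eventually_at_right_less[of 0] by eventually_elim (rule large_nets_at_scale)
  then show ?thesis by (simp add: eventually_at_right_field imp_conjL net_gain_def)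
qed

end
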